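(* Let ALG be a $\beta$-approximation for the capacitated $k$-center. Then, for fixed $\alpha$, the following algorithm (Algorithm 2) is a $(\beta+6\alpha)$-approximation for the capacitated conservative $\alpha$-fault-tolerant $k$-center. Input: connected unweighted graph $G=(V,E)$, $k$, and $L:V\to\mathbb{Z}_{\ge0}$. (1) For each $u$ with $L_u>|V|$, set $L_u\leftarrow|V|$. (2) $B\leftarrow\emptyset$; while there is a set $U\subseteq V$ with $|U|\le\alpha$ and $L(U)>L(B\cap N^6(U))$, set $B\leftarrow(B\setminus N^6(U))\cup U$. (3) Let $L'_u=0$ for $u\in B$ and $L'_u=L_u$ otherwise. (4) If ALG$(G,k-|B|,L')$ returns failure, return failure; otherwise, with $(S,\phi)$ the returned solution, return $(S\cup B,\phi)$.
   Context: $d$ is the shortest-path metric of $G$; $N^\ell(U)=\{v:d(v,u)\le\ell\text{ for some }u\in U\}$; $L(X)=\sum_{x\in X}L_x$. A distance-$r$ solution for the capacitated $k$-center instance $(G,k,L)$ is a set $S$ of at most $k$ centers with an assignment $\phi:V\to S$, $|\phi^{-1}(v)|\le L_v$, $d(u,\phi(u))\le r$. A distance-$r$ solution for the capacitated conservative $\alpha$-fault-tolerant $k$-center instance $(G,k,L,\alpha)$ is a pair $(S,\phi_0)$ with $|S|\le k$, $\phi_0:V\to S$ capacity-respecting with $d(u,\phi_0(u))\le r$, such that for each $F\subseteq S$ with $|F|\le\alpha$ there is a capacity-respecting $\phi_F:V\to S\setminus F$ with $d(u,\phi_F(u))\le r$ for all $u$ and $\phi_F(u)=\phi_0(u)$ whenever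 $\phi_0(u)\notin F$. An algorithm is a $\rho$-approximation (in this unweighted formulation) if it runs in polynomial time and either returns failure, only when no distance-$1$ solution exists, or returns a distance-$\rho$ solution; via the standard threshold-graph and connected-component reductions, this yields a $\rho$-approximation for arbitrary metrics. *)

theory Defs
  imports
    "Graph_Theory.Shortest_Path"
    "Graph_Theory.Pair_Digraph"
    "Graph_Theory.Digraph_Component"
    "HOL-Library.FuncSet"
    "HOL-Library.Log_Nat"
    "HOL-Computational_Algebra.Polynomial"
begin

section \<open>Capacitated and conservative fault-tolerant \<open>k\<close>-center\<close>

type_synonym 'a kcenter = "'a pair_pre_digraph \<times> nat \<times> ('a \<Rightarrow> nat)"

text \<open>A finite simple undirected graph is a \<^locale>\<open>pair_graph\<close>, that is, a finite loop-free
  symmetric digraph.\<close>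

definition gdist :: "'a pair_pre_digraph \<Rightarrow> 'a \<Rightarrow> 'a \<Rightarrow> ereal" where
  "gdist G u v = wf_digraph.\<mu> (with_proj G) (\<lambda>_. 1) u v"

definition nbhd :: "'a pair_pre_digraph \<Rightarrow> nat \<Rightarrow> 'a set \<Rightarrow> 'a set" where
  "nbhd G l U = {v \<in> pverts G. \<exists>u \<in> U. gdist G v u \<le> ereal (real l)}"

text \<open>\<open>\<phi>\<close> assigns all vertices to the centers in \<open>S\<close>, respecting capacities and within distance
  \<open>r\<close>. Its values outside the vertex set are irrelevant.\<close>

definition assignment ::
  "'a pair_pre_digraph \<Rightarrow> ('a \<Rightarrow> nat) \<Rightarrow> real \<Rightarrow> 'a set \<Rightarrow> ('a \<Rightarrow> 'a) \<Rightarrow> bool" where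
  "assignment G L r S \<phi> \<longleftrightarrow>
     \<phi> \<in> pverts G \<rightarrow> S \<and>
     (\<forall>v \<in> pverts G. card {u \<in> pverts G. \<phi> u = v} \<le> L v) \<and>
     (\<forall>u \<in> pverts G. gdist G u (\<phi> u) \<le> ereal r)"

fun cap_solution :: "real \<Rightarrow> 'a kcenter \<Rightarrow> 'a set \<times> ('a \<Rightarrow> 'a) \<Rightarrow> bool" where
  "cap_solution r (G, k, L) (S, \<phi>) \<longleftrightarrow>
     S \<subseteq> pverts G \<and> card S \<le> k \<and> assignment G L r S \<phi>"

fun ft_solution :: "nat \<Rightarrow> real \<Rightarrow> 'a kcenter \<Rightarrow> 'a set \<times> ('a \<Rightarrow> 'a) \<Rightarrow> bool" where
  "ft_solution \<alpha> r (G, k, L) (S, \<phi>\<^sub>0) \<longleftrightarrow>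
     S \<subseteq> pverts G \<and> card S \<le> k \<and> assignment G L r S \<phi>\<^sub>0 \<and>
     (\<forall>F \<subseteq> S. card F \<le> \<alpha> \<longrightarrow>
        (\<exists>\<phi>F. assignment G L r (S - F) \<phi>F \<and>
              (\<forall>u \<in> pverts G. \<phi>\<^sub>0 u \<notin> F \<longrightarrow> \<phi>F u = \<phi>\<^sub>0 u)))"


section \<open>A model of computation\<close>

text \<open>
  Programs are while programs transforming a single piece of data, which is a binary tree with
  natural numbers at its leaves. The numbers are measured in binary, and every primitive step is
  charged for the size of the data it reads and writes. Hence a run of cost \<open>t\<close> can be simulated
  by a Turing machine in time polynomial in \<open>t\<close>, and conversely.
\<close>

datatype val = Num nat | Cell val val

fun vsize :: "val \<Rightarrow> nat" where
  "vsize (Num n) = 1 + floorlog 2 n"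
| "vsize (Cell a b) = 1 + vsize a + vsize b"

datatype prim = Ident | Const val | First | Second | Add | Sub

text \<open>\<open>Sub\<close> is truncated subtraction. Primitives applied to data of the wrong shape yield
  \<open>Num 0\<close>.\<close>

fun apply_prim :: "prim \<Rightarrow> val \<Rightarrow> val" where
  "apply_prim Ident x = x"
| "apply_prim (Const c) x = c"
| "apply_prim First (Cell a b) = a"
| "apply_prim Second (Cell a b) = b"
| "apply_prim Add (Cell (Num m) (Num n)) = Num (m + n)"
| "apply_prim Sub (Cell (Num m) (Num n)) = Num (m - n)"
| "apply_prim _ _ = Num 0"

datatype prog =
    Prim prim
  | Seq prog prog
  | Both prog prog
  | Cond prog prog prog
  | While prog prog

text \<open>\<open>exec p x t y\<close>: program \<open>p\<close>, started on data \<open>x\<close>, halts after \<open>t\<close> steps with result \<open>y\<close>.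
  As a test result, \<open>Num 0\<close> means false and everything else means true.\<close>

inductive exec :: "prog \<Rightarrow> val \<Rightarrow> nat \<Rightarrow> val \<Rightarrow> bool" where
  Prim: "exec (Prim f) x (vsize x + vsize (apply_prim f x)) (apply_prim f x)"
| Seq: "exec p x s y \<Longrightarrow> exec q y t z \<Longrightarrow> exec (Seq p q) x (s + t + 1) z"
| Both: "exec p x s y \<Longrightarrow> exec q x t z \<Longrightarrow> exec (Both p q) x (s + t + 1) (Cell y z)"
| CondTrue: "exec b x s c \<Longrightarrow> c \<noteq> Num 0 \<Longrightarrow> exec p x t y \<Longrightarrow> exec (Cond b p q) x (s + t + 1) y"
| CondFalse: "exec b x s (Num 0) \<Longrightarrow> exec q x t y \<Longrightarrow> exec (Cond b p q) x (s + t + 1) y"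
| WhileFalse: "exec b x s (Num 0) \<Longrightarrow> exec (While b p) x (s + 1) x"
| WhileTrue: "exec b x s c \<Longrightarrow> c \<noteq> Num 0 \<Longrightarrow> exec p x t y \<Longrightarrow> exec (While b p) y w z \<Longrightarrow>
    exec (While b p) x (s + t + w + 1) z"

lemma exec_deterministic:
  "exec p x t y \<Longrightarrow> exec p x t' y' \<Longrightarrow> t' = t \<and> y' = y"
proof (induction arbitrary: t' y' rule: exec.induct)
  case (Prim f x)
  then show ?case by (auto elim: exec.cases)
next
  case (Seq p x s y q t z)
  from Seq.prems show ?case by cases (use Seq.IH in blast)
next
  case (Both p x s y q t z)
  from Both.prems show ?case by cases (use Both.IH in blast)
next
  case (CondTrue b x s c p t y q)
  from CondTrue.prems show ?case by cases (use CondTrue.IH CondTrue.hyps in blast)+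
next
  case (CondFalse b x s q t y p)
  from CondFalse.prems show ?case by cases (use CondFalse.IH in blast)+
next
  case (WhileFalse b x s p)
  from WhileFalse.prems show ?case by cases (use WhileFalse.IH in blast)+
next
  case (WhileTrue b x s c p t y w z)
  from WhileTrue.prems show ?case by cases (use WhileTrue.IH WhileTrue.hyps in blast)+
qed

lemma vsize_le_cost: "exec p x t y \<Longrightarrow> vsize x \<le> t \<and> vsize y \<le> t"
  by (induction rule: exec.induct) auto

text \<open>On the encodings of all \<open>a \<in> A\<close>, program \<open>p\<close> halts within polynomial time with a result
  that meets the specification \<open>R a\<close>.\<close>

definition poly_time_realizes ::
  "prog \<Rightarrow> 'a set \<Rightarrow> ('a \<Rightarrow> val) \<Rightarrow> ('a \<Rightarrow> val \<Rightarrow> bool) \<Rightarrow> bool" where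
  "poly_time_realizes p A enc R \<longleftrightarrow>
     (\<exists>b :: nat poly. \<forall>a \<in> A. \<exists>t y. exec p (enc a) t y \<and> t \<le> poly b (vsize (enc a)) \<and> R a y)"


section \<open>Encodings\<close>

definition enc_list :: "val list \<Rightarrow> val" where
  "enc_list xs = foldr Cell xs (Num 0)"

text \<open>For the purpose of encoding, the vertices are numbered \<open>0, \<dots>, n - 1\<close>. Sets of vertices are
  encoded by characteristic vectors, functions on vertices by lists of values, and graphs by
  adjacency matrices.\<close>

definition inputs :: "nat kcenter set" where
  "inputs = {(G, k, L). pair_graph G \<and> Digraph_Component.connected (with_proj G) \<and>
     (\<exists>n. pverts G = {0..<n})}"

definition enc_fun :: "nat pair_pre_digraph \<Rightarrow> (nat \<Rightarrow> nat) \<Rightarrow> val" where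
  "enc_fun G f = enc_list (map (\<lambda>v. Num (f v)) [0..<card (pverts G)])"

definition enc_set :: "nat pair_pre_digraph \<Rightarrow> nat set \<Rightarrow> val" where
  "enc_set G X = enc_fun G (\<lambda>v. if v \<in> X then 1 else 0)"

definition enc_graph :: "nat pair_pre_digraph \<Rightarrow> val" where
  "enc_graph G =
     enc_list (map (\<lambda>u. enc_set G {v. (u, v) \<in> parcs G}) [0..<card (pverts G)])"

fun enc_input :: "nat kcenter \<Rightarrow> val" where
  "enc_input (G, k, L) = Cell (enc_graph G) (Cell (Num k) (enc_fun G L))"

text \<open>The result \<open>None\<close> stands for failure.\<close>

fun enc_result :: "nat pair_pre_digraph \<Rightarrow> (nat set \<times> (nat \<Rightarrow> nat)) option \<Rightarrow> val" where
  "enc_result G None = Num 0"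
| "enc_result G (Some (S, \<phi>)) = Cell (enc_set G S) (enc_fun G \<phi>)"


section \<open>Approximation algorithms\<close>

definition approximation ::
  "(real \<Rightarrow> nat kcenter \<Rightarrow> nat set \<times> (nat \<Rightarrow> nat) \<Rightarrow> bool) \<Rightarrow> real \<Rightarrow> prog \<Rightarrow> bool" where
  "approximation sol \<rho> p \<longleftrightarrow>
     poly_time_realizes p inputs enc_input
       (\<lambda>I y. \<exists>res. y = enc_result (fst I) res \<and>
          (case res of
             None \<Rightarrow> \<not> (\<exists>s. sol 1 I s)
           | Some s \<Rightarrow> sol \<rho> I s))"

definition cap_approximation :: "real \<Rightarrow> prog \<Rightarrow> bool" where
  "cap_approximation = approximation cap_solution"

definition ft_approximation :: "nat \<Rightarrow> real \<Rightarrow> prog \<Rightarrow> bool" where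
  "ft_approximation \<alpha> = approximation (ft_solution \<alpha>)"


section \<open>The algorithm\<close>

text \<open>The state of the main loop consists of the instance, with its current capacities, and of
  the set \<open>B\<close>.\<close>

type_synonym state = "nat kcenter \<times> nat set"

definition states :: "state set" where
  "states = {((G, k, L), B). (G, k, L) \<in> inputs \<and> B \<subseteq> pverts G}"

fun enc_state :: "state \<Rightarrow> val" where
  "enc_state ((G, k, L), B) = Cell (enc_input (G, k, L)) (enc_set G B)"

fun violating :: "nat \<Rightarrow> state \<Rightarrow> nat set \<Rightarrow> bool" where
  "violating \<alpha> ((G, k, L), B) U \<longleftrightarrow>
     U \<subseteq> pverts G \<and> card U \<le> \<alpha> \<and> sum L U > sum L (B \<inter> nbhd G 6 U)"

fun cap_capacities :: "nat kcenter \<Rightarrow> nat kcenter" where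
  "cap_capacities (G, k, L) =
     (G, k, \<lambda>u. if L u > card (pverts G) then card (pverts G) else L u)"

fun replace :: "state \<Rightarrow> nat set \<Rightarrow> state" where
  "replace ((G, k, L), B) U = ((G, k, L), (B - nbhd G 6 U) \<union> U)"

text \<open>If \<open>k < |B|\<close>, the truncated difference leaves an instance with a budget of no centers, which
  is as infeasible as one with a negative budget, since inputs are nonempty.\<close>

fun reduced :: "state \<Rightarrow> nat kcenter" where
  "reduced ((G, k, L), B) = (G, k - card B, \<lambda>u. if u \<in> B then 0 else L u)"

fun add_backups ::
  "state \<Rightarrow> (nat set \<times> (nat \<Rightarrow> nat)) option \<Rightarrow> (nat set \<times> (nat \<Rightarrow> nat)) option" where
  "add_backups ((G, k, L), B) None = None"
| "add_backups ((G, k, L), B) (Some (S, \<phi>)) = Some (S \<union> B, \<phi>)"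

definition calls :: "(state \<times> (nat set \<times> (nat \<Rightarrow> nat)) option) set" where
  "calls = {(((G, k, L), B), res). ((G, k, L), B) \<in> states \<and>
     (\<forall>S \<phi>. res = Some (S, \<phi>) \<longrightarrow> S \<subseteq> pverts G \<and> \<phi> \<in> pverts G \<rightarrow> S)}"

fun enc_call :: "state \<times> (nat set \<times> (nat \<Rightarrow> nat)) option \<Rightarrow> val" where
  "enc_call (((G, k, L), B), res) = Cell (enc_result G res) (enc_state ((G, k, L), B))"

text \<open>
  The implementations of the algorithm for a fixed \<open>\<alpha>\<close>, given the program \<open>ALG\<close>. The main loop
  may pick any violating set: every way of choosing one that \<open>update\<close> can realize in polynomial
  time gives an implementation. That \<open>test\<close> and \<open>update\<close> do exist is not part of this definition.
\<close>

definition implementation :: "nat \<Rightarrow> prog \<Rightarrow> prog \<Rightarrow> bool" where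
  "implementation \<alpha> ALG p \<longleftrightarrow>
     (\<exists>init test update reduce output.
        p = Seq init (Seq (While test update)
              (Seq (Both (Seq reduce ALG) (Prim Ident)) output)) \<and>
        poly_time_realizes init inputs enc_input
          (\<lambda>I y. y = enc_state (cap_capacities I, {})) \<and>
        poly_time_realizes test states enc_state
          (\<lambda>s y. y \<noteq> Num 0 \<longleftrightarrow> (\<exists>U. violating \<alpha> s U)) \<and>
        poly_time_realizes update {s \<in> states. \<exists>U. violating \<alpha> s U} enc_state
          (\<lambda>s y. \<exists>U. violating \<alpha> s U \<and> y = enc_state (replace s U)) \<and>
        poly_time_realizes reduce states enc_state
          (\<lambda>s y. y = enc_input (reduced s)) \<and>
        poly_time_realizes output calls enc_call
          (\<lambda>(s, res) y. y = enc_result (fst (fst s)) (add_backups s res)))"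

end

(*
Soundness. No clients are assigned to the backup centers in B. If F fails, the failed backups in
F are themselves replaced: closing a set A of failed centers under hops of length 6 inside F and
applying the stopping criterion of the loop to the closure gives L(A) <= L(backups outside F within
6 |F| of A). This is Hall's condition for moving the clients of F to surviving backups at an
additional distance of 6 alpha.

Completeness. The loop keeps B partitioned into sets W with |W| <= alpha and mutual distances
greater than 6. From a distance-1 fault-tolerant solution, let |W| centers next to each W fail;
the resulting reassignments stay within distance 3 of W, hence combine to a solution of the reduced
instance with |B| fewer centers.

Running time. L(B) increases in each iteration and is at most |V|^2. A violating set is found by
trying all sequences of alpha vertices. That everything is computable in polynomial time follows
from closure properties: sums, comprehensions and searches over the vertices all reduce to one
loop rule, in which the intermediate values are described by a function F of the input and the
index, and need polynomial size.
*)

theory Submission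
  imports Defs
begin


section \<open>Polynomial time\<close>

text \<open>The 6 in the algorithm is twice 3. In the completeness part, a moved client leads from
  \<open>w\<close> in W over its old center and itself to its new center, three edges in all; balls
  of radius 3 around parts more than 6 apart are disjoint. What allows the reassignments for
  different W to be combined is that they are conservative: a client whose center survives keeps it,
  so the assignment answering the failure next to W moves only clients of centers next to W. For
  soundness, the zero capacities of B in the reduced instance are a reservation: a surviving backup
  has its whole capacity left for displaced clients. Lowering the capacities to |V| makes the loop
  short. Capacities are given in binary, so without this step L(B) could climb through exponentially
  many values. The binary encoding also shapes the loop rule: the number of rounds has to come from
  the length of a list and not from a number.\<close>

definition poly_bounded :: "'a set \<Rightarrow> ('a \<Rightarrow> nat) \<Rightarrow> ('a \<Rightarrow> nat) \<Rightarrow> bool" where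
  "poly_bounded A m f \<longleftrightarrow> (\<exists>b :: nat poly. \<forall>a\<in>A. f a \<le> poly b (m a))"

lemma poly_mono_nat: "x \<le> y \<Longrightarrow> poly (b :: nat poly) x \<le> poly b y"
  by (induction b) (auto intro!: add_mono mult_mono)

lemma poly_bounded_poly: "poly_bounded A m (\<lambda>a. poly b (m a))"
  unfolding poly_bounded_def by blast

lemma poly_bounded_mono:
  assumes "poly_bounded A m g" "\<And>a. a \<in> A \<Longrightarrow> f a \<le> g a"
  shows "poly_bounded A m f"
  using assms unfolding poly_bounded_def by (meson order_trans)

lemma poly_bounded_const: "poly_bounded A m (\<lambda>_. c)"
  unfolding poly_bounded_def by (rule exI[of _ "[:c:]"]) simp

lemma poly_bounded_self: "poly_bounded A m m"
  unfolding poly_bounded_def by (rule exI[of _ "[:0, 1:]"]) simp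

lemma poly_bounded_add:
  assumes "poly_bounded A m f" "poly_bounded A m g"
  shows "poly_bounded A m (\<lambda>a. f a + g a)"
proof -
  obtain b c :: "nat poly" where "\<forall>a\<in>A. f a \<le> poly b (m a)" "\<forall>a\<in>A. g a \<le> poly c (m a)"
    using assms unfolding poly_bounded_def by blast
  then show ?thesis
    unfolding poly_bounded_def by (intro exI[of _ "b + c"]) (simp add: add_mono)
qed

lemma poly_bounded_mult:
  assumes "poly_bounded A m f" "poly_bounded A m g"
  shows "poly_bounded A m (\<lambda>a. f a * g a)"
proof -
  obtain b c :: "nat poly" where "\<forall>a\<in>A. f a \<le> poly b (m a)" "\<forall>a\<in>A. g a \<le> poly c (m a)"
    using assms unfolding poly_bounded_def by blast
  then show ?thesis
    unfolding poly_bounded_def by (intro exI[of _ "b * c"]) (simp add: mult_mono)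
qed

text \<open>Polynomials over the naturals are monotone, so the bound \<open>g\<close> on the size of
  the intermediate object \<open>h a\<close> can be substituted into the bound for
  \<open>f\<close>.\<close>

lemma poly_bounded_comp:
  assumes "poly_bounded B m' f" "poly_bounded A m g"
    and "\<And>a. a \<in> A \<Longrightarrow> h a \<in> B" "\<And>a. a \<in> A \<Longrightarrow> m' (h a) \<le> g a"
  shows "poly_bounded A m (\<lambda>a. f (h a))"
proof -
  obtain b c :: "nat poly" where b: "\<forall>x\<in>B. f x \<le> poly b (m' x)"
    and c: "\<forall>a\<in>A. g a \<le> poly c (m a)"
    using assms(1,2) unfolding poly_bounded_def by blast
  have "f (h a) \<le> poly (pcompose b c) (m a)" if "a \<in> A" for a
  proof -
    have "f (h a) \<le> poly b (m' (h a))" using b assms(3) that by blast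
    also have "\<dots> \<le> poly b (poly c (m a))"
      using assms(4)[OF that] c that by (blast intro: poly_mono_nat order_trans)
    finally show ?thesis by (simp add: poly_pcompose)
  qed
  then show ?thesis unfolding poly_bounded_def by blast
qed

text \<open>The time bound may be any polynomially bounded function, so it can be assembled by the
  closure rules above instead of naming a polynomial.\<close>

lemma realizes_iff:
  "poly_time_realizes p A enc R \<longleftrightarrow>
    (\<exists>T. poly_bounded A (\<lambda>a. vsize (enc a)) T \<and>
      (\<forall>a\<in>A. \<exists>t y. exec p (enc a) t y \<and> t \<le> T a \<and> R a y))"
  (is "?l \<longleftrightarrow> ?r")
proof
  assume ?l
  then show ?r unfolding poly_time_realizes_def using poly_bounded_poly by fastforce
next
  assume ?r
  then show ?l unfolding poly_time_realizes_def poly_bounded_def by (meson order_trans)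
qed

section \<open>Composition rules for programs\<close>

lemma realizes_mono:
  assumes "poly_time_realizes p A enc R" "\<And>a y. a \<in> A \<Longrightarrow> R a y \<Longrightarrow> S a y"
  shows "poly_time_realizes p A enc S"
  using assms unfolding poly_time_realizes_def by meson

text \<open>The intermediate value is no larger than the running time of \<open>p\<close>, since
  each step pays for what it writes. \<open>Q\<close> records how the intermediate object depends on
  the input, because specifications may admit several results.\<close>

lemma realizes_Seq:
  assumes p: "poly_time_realizes p A enc R"
    and q: "poly_time_realizes q B enc' S"
    and link: "\<And>a y. a \<in> A \<Longrightarrow> R a y \<Longrightarrow> \<exists>b\<in>B. y = enc' b \<and> Q a b"
  shows "poly_time_realizes (Seq p q) A enc (\<lambda>a z. \<exists>b\<in>B. Q a b \<and> S b z)"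
proof -
  obtain P1 P2 :: "nat poly"
    where P1: "\<And>a. a \<in> A \<Longrightarrow> \<exists>t y. exec p (enc a) t y \<and> t \<le> poly P1 (vsize (enc a)) \<and> R a y"
      and P2: "\<And>b. b \<in> B \<Longrightarrow> \<exists>t y. exec q (enc' b) t y \<and> t \<le> poly P2 (vsize (enc' b)) \<and> S b y"
    using p q unfolding poly_time_realizes_def by meson
  have "\<exists>t z. exec (Seq p q) (enc a) t z \<and> t \<le> poly (P1 + pcompose P2 P1 + 1) (vsize (enc a)) \<and>
      (\<exists>b\<in>B. Q a b \<and> S b z)" if a: "a \<in> A" for a
  proof -
    obtain t y where 1: "exec p (enc a) t y" "t \<le> poly P1 (vsize (enc a))" "R a y"
      using P1[OF a] by blast
    obtain b where b: "b \<in> B" "y = enc' b" "Q a b" using link[OF a 1(3)] by blast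
    obtain t' z where 2: "exec q (enc' b) t' z" "t' \<le> poly P2 (vsize (enc' b))" "S b z"
      using P2[OF b(1)] by blast
    have "vsize (enc' b) \<le> poly P1 (vsize (enc a))"
      using vsize_le_cost[OF 1(1)] 1(2) b(2) by simp
    then have "t' \<le> poly P2 (poly P1 (vsize (enc a)))"
      using 2(2) poly_mono_nat order_trans by blast
    then have "t + t' + 1 \<le> poly (P1 + pcompose P2 P1 + 1) (vsize (enc a))"
      using 1(2) by (simp add: poly_pcompose)
    moreover have "exec (Seq p q) (enc a) (t + t' + 1) z"
      using exec.Seq[OF 1(1)] 2(1) b(2) by blast
    ultimately show ?thesis using b 2(3) by blast
  qed
  then show ?thesis unfolding poly_time_realizes_def by blast
qed

lemma realizes_Both:
  assumes "poly_time_realizes p A enc R" "poly_time_realizes q A enc S"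
  shows "poly_time_realizes (Both p q) A enc (\<lambda>a z. \<exists>x y. z = Cell x y \<and> R a x \<and> S a y)"
proof -
  obtain T1 T2 where T: "poly_bounded A (\<lambda>a. vsize (enc a)) T1" "poly_bounded A (\<lambda>a. vsize (enc a)) T2"
    and 1: "\<forall>a\<in>A. \<exists>t y. exec p (enc a) t y \<and> t \<le> T1 a \<and> R a y"
    and 2: "\<forall>a\<in>A. \<exists>t y. exec q (enc a) t y \<and> t \<le> T2 a \<and> S a y"
    using assms unfolding realizes_iff by blast
  have "\<exists>t z. exec (Both p q) (enc a) t z \<and> t \<le> T1 a + T2 a + 1 \<and>
      (\<exists>x y. z = Cell x y \<and> R a x \<and> S a y)" if a: "a \<in> A" for a
  proof -
    obtain t x t' y where p: "exec p (enc a) t x" "t \<le> T1 a" "R a x"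
      and q: "exec q (enc a) t' y" "t' \<le> T2 a" "S a y"
      using 1 2 a by blast
    have "exec (Both p q) (enc a) (t + t' + 1) (Cell x y)" using p q by (blast intro: exec.Both)
    moreover have "t + t' + 1 \<le> T1 a + T2 a + 1" using p q by simp
    ultimately show ?thesis using p q by blast
  qed
  moreover have "poly_bounded A (\<lambda>a. vsize (enc a)) (\<lambda>a. T1 a + T2 a + 1)"
    by (intro poly_bounded_add poly_bounded_const T)
  ultimately show ?thesis unfolding realizes_iff by blast
qed

lemma realizes_Cond:
  assumes b: "poly_time_realizes b A enc (\<lambda>a y. y \<noteq> Num 0 \<longleftrightarrow> P a)"
    and p: "poly_time_realizes p {a \<in> A. P a} enc R"
    and q: "poly_time_realizes q {a \<in> A. \<not> P a} enc R"
  shows "poly_time_realizes (Cond b p q) A enc R"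
proof -
  obtain B1 :: "nat poly" where
    1: "\<forall>a\<in>A. \<exists>t y. exec b (enc a) t y \<and> t \<le> poly B1 (vsize (enc a)) \<and> (y \<noteq> Num 0 \<longleftrightarrow> P a)"
    using b unfolding poly_time_realizes_def by blast
  obtain B2 :: "nat poly" where
    2: "\<forall>a\<in>A. P a \<longrightarrow> (\<exists>t y. exec p (enc a) t y \<and> t \<le> poly B2 (vsize (enc a)) \<and> R a y)"
    using p unfolding poly_time_realizes_def by blast
  obtain B3 :: "nat poly" where
    3: "\<forall>a\<in>A. \<not> P a \<longrightarrow> (\<exists>t y. exec q (enc a) t y \<and> t \<le> poly B3 (vsize (enc a)) \<and> R a y)"
    using q unfolding poly_time_realizes_def by blast
  have "\<exists>t y. exec (Cond b p q) (enc a) t y \<and> t \<le> poly (B1 + B2 + B3 + 1) (vsize (enc a)) \<and> R a y"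
    if a: "a \<in> A" for a
  proof -
    obtain t c where c: "exec b (enc a) t c" "t \<le> poly B1 (vsize (enc a))" "c \<noteq> Num 0 \<longleftrightarrow> P a"
      using 1 a by blast
    show ?thesis
    proof (cases "P a")
      case True
      then obtain t' y where "exec p (enc a) t' y" "t' \<le> poly B2 (vsize (enc a))" "R a y"
        using 2 a by blast
      moreover from calculation c True have "exec (Cond b p q) (enc a) (t + t' + 1) y"
        by (blast intro: exec.CondTrue)
      moreover from calculation c have "t + t' + 1 \<le> poly (B1 + B2 + B3 + 1) (vsize (enc a))"
        by simp
      ultimately show ?thesis by blast
    next
      case False
      then obtain t' y where "exec q (enc a) t' y" "t' \<le> poly B3 (vsize (enc a))" "R a y"
        using 3 a by blast
      moreover from calculation c False have "exec (Cond b p q) (enc a) (t + t' + 1) y"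
        by (blast intro: exec.CondFalse)
      moreover from calculation c have "t + t' + 1 \<le> poly (B1 + B2 + B3 + 1) (vsize (enc a))"
        by simp
      ultimately show ?thesis by blast
    qed
  qed
  then show ?thesis unfolding poly_time_realizes_def by blast
qed

text \<open>Sizes of reachable states are bounded in terms of the initial state, because a
  polynomial bound per round would compound over the rounds. The number of rounds is limited by the
  measure \<open>M\<close>.\<close>

lemma realizes_While:
  assumes test: "poly_time_realizes b A enc (\<lambda>s y. y \<noteq> Num 0 \<longleftrightarrow> P s)"
    and body: "poly_time_realizes p {s \<in> A. P s} enc (\<lambda>s y. \<exists>s'\<in>A. y = enc s' \<and> step s s')"
    and size: "poly_bounded {(s, s'). s \<in> A \<and> step\<^sup>*\<^sup>* s s'} (\<lambda>x. vsize (enc (fst x)))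
      (\<lambda>x. vsize (enc (snd x)))"
    and decreasing: "\<And>s s'. s \<in> A \<Longrightarrow> s' \<in> A \<Longrightarrow> P s \<Longrightarrow> step s s' \<Longrightarrow> M s' < M s"
    and bounded: "poly_bounded A (\<lambda>s. vsize (enc s)) M"
  shows "poly_time_realizes (While b p) A enc
    (\<lambda>s y. \<exists>s'\<in>A. y = enc s' \<and> step\<^sup>*\<^sup>* s s' \<and> \<not> P s')"
proof -
  obtain B1 :: "nat poly" where
    1: "\<And>s. s \<in> A \<Longrightarrow> \<exists>t y. exec b (enc s) t y \<and> t \<le> poly B1 (vsize (enc s)) \<and> (y \<noteq> Num 0 \<longleftrightarrow> P s)"
    using test unfolding poly_time_realizes_def by blast
  obtain B2 :: "nat poly" where
    2: "\<And>s. s \<in> A \<Longrightarrow> P s \<Longrightarrow> \<exists>t y. exec p (enc s) t y \<and> t \<le> poly B2 (vsize (enc s)) \<and>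
          (\<exists>s'\<in>A. y = enc s' \<and> step s s')"
    using body unfolding poly_time_realizes_def by blast
  obtain C :: "nat poly" where
    C: "\<And>s s'. s \<in> A \<Longrightarrow> step\<^sup>*\<^sup>* s s' \<Longrightarrow> vsize (enc s') \<le> poly C (vsize (enc s))"
    using size unfolding poly_bounded_def by auto
  \<comment> \<open>Cost of one round, with the size of the current state replaced by its bound in
    terms of the start.\<close>
  define K where "K s = poly (pcompose B1 C) (vsize (enc s)) + poly (pcompose B2 C) (vsize (enc s)) + 1"
    for s
  \<comment> \<open>\<open>K\<close> stays fixed at the start \<open>s0\<close> while
    \<open>s\<close> moves on. The additional round in \<open>M s + 1\<close> pays for the final,
    failing test.\<close>
  have "\<exists>t s'. exec (While b p) (enc s) t (enc s') \<and> t \<le> (M s + 1) * K s0 \<and> s' \<in> A \<and>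
      step\<^sup>*\<^sup>* s s' \<and> \<not> P s'" if "s0 \<in> A" "s \<in> A" "step\<^sup>*\<^sup>* s0 s" for s0 s
    using that(2,3)
  proof (induction "M s" arbitrary: s rule: less_induct)
    case less
    note sz = C[OF that(1) less.prems(2)]
    obtain t c where c: "exec b (enc s) t c" "t \<le> poly B1 (vsize (enc s))" "c \<noteq> Num 0 \<longleftrightarrow> P s"
      using 1 less.prems(1) by blast
    have t: "t \<le> poly B1 (poly C (vsize (enc s0)))"
      using c(2) poly_mono_nat[OF sz] order_trans by blast
    show ?case
    proof (cases "P s")
      case False
      then have "exec (While b p) (enc s) (t + 1) (enc s)"
        using c exec.WhileFalse by fastforce
      moreover have "t + 1 \<le> (M s + 1) * K s0"
        using t by (simp add: K_def poly_pcompose)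
      ultimately show ?thesis using False less.prems by blast
    next
      case True
      obtain t' s' where s': "exec p (enc s) t' (enc s')" "t' \<le> poly B2 (vsize (enc s))"
        "s' \<in> A" "step s s'"
        using 2 less.prems(1) True by blast
      have t': "t' \<le> poly B2 (poly C (vsize (enc s0)))"
        using s'(2) poly_mono_nat[OF sz] order_trans by blast
      have M: "M s' < M s" using decreasing less.prems(1) s' True by blast
      have "step\<^sup>*\<^sup>* s0 s'" using less.prems(2) s'(4) by (rule rtranclp.rtrancl_into_rtrancl)
      then obtain t'' s'' where s'': "exec (While b p) (enc s') t'' (enc s'')"
        "t'' \<le> (M s' + 1) * K s0" "s'' \<in> A" "step\<^sup>*\<^sup>* s' s''" "\<not> P s''"
        using less.hyps[OF M s'(3)] by blast
      have "exec (While b p) (enc s) (t + t' + t'' + 1) (enc s'')"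
        using exec.WhileTrue[OF c(1) _ s'(1) s''(1)] c(3) True by blast
      moreover have "t + t' + t'' + 1 \<le> (M s + 1) * K s0"
      proof -
        have "t + t' + 1 \<le> K s0" using t t' by (simp add: K_def poly_pcompose)
        then have "t + t' + t'' + 1 \<le> K s0 + (M s' + 1) * K s0" using s''(2) by linarith
        also have "\<dots> = (M s' + 1 + 1) * K s0" by simp
        also have "\<dots> \<le> (M s + 1) * K s0" using M by (intro mult_right_mono) auto
        finally show ?thesis .
      qed
      moreover have "step\<^sup>*\<^sup>* s s''" using s'(4) s''(4) by (rule converse_rtranclp_into_rtranclp)
      ultimately show ?thesis using s'' by blast
    qed
  qed
  then have "\<forall>s\<in>A. \<exists>t y. exec (While b p) (enc s) t y \<and> t \<le> (M s + 1) * K s \<and>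
      (\<exists>s'\<in>A. y = enc s' \<and> step\<^sup>*\<^sup>* s s' \<and> \<not> P s')"
    by blast
  moreover have "poly_bounded A (\<lambda>s. vsize (enc s)) (\<lambda>s. (M s + 1) * K s)"
    unfolding K_def
    by (intro poly_bounded_mult poly_bounded_add poly_bounded_const bounded poly_bounded_poly)
  ultimately show ?thesis unfolding realizes_iff by (intro exI conjI)
qed

text \<open>Hiding the program lets the constructions below proceed by closure rules on
  functions.\<close>

definition ptime :: "'a set \<Rightarrow> ('a \<Rightarrow> val) \<Rightarrow> ('a \<Rightarrow> val) \<Rightarrow> bool" where
  "ptime A enc f \<longleftrightarrow> (\<exists>p. poly_time_realizes p A enc (\<lambda>a y. y = f a))"

lemma ptimeI: "poly_time_realizes p A enc (\<lambda>a y. y = f a) \<Longrightarrow> ptime A enc f"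
  unfolding ptime_def by blast

lemma ptime_cong:
  assumes "ptime A enc f" "\<And>a. a \<in> A \<Longrightarrow> enc a = enc' a" "\<And>a. a \<in> A \<Longrightarrow> f a = f' a"
  shows "ptime A enc' f'"
  using assms unfolding ptime_def poly_time_realizes_def by simp

lemma ptime_subset: "ptime A enc f \<Longrightarrow> B \<subseteq> A \<Longrightarrow> ptime B enc f"
  unfolding ptime_def poly_time_realizes_def by (meson subsetD)

lemma ptime_vsize:
  assumes "ptime A enc f"
  shows "poly_bounded A (\<lambda>a. vsize (enc a)) (\<lambda>a. vsize (f a))"
  using assms vsize_le_cost unfolding ptime_def poly_time_realizes_def poly_bounded_def
  by (meson order_trans)

lemma ptime_comp:
  assumes "ptime A enc (\<lambda>a. enc' (h a))" "ptime B enc' g" "\<And>a. a \<in> A \<Longrightarrow> h a \<in> B"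
  shows "ptime A enc (\<lambda>a. g (h a))"
proof -
  obtain p q where p: "poly_time_realizes p A enc (\<lambda>a y. y = enc' (h a))"
    and q: "poly_time_realizes q B enc' (\<lambda>b y. y = g b)"
    using assms unfolding ptime_def by blast
  have "poly_time_realizes (Seq p q) A enc (\<lambda>a z. \<exists>b\<in>B. b = h a \<and> z = g b)"
    by (rule realizes_Seq[OF p q]) (use assms(3) in auto)
  then have "poly_time_realizes (Seq p q) A enc (\<lambda>a z. z = g (h a))"
    by (rule realizes_mono) blast
  then show ?thesis by (rule ptimeI)
qed

text \<open>The object stays the same and only its encoding changes: a program for a lean encoding
  also serves a richer one from which the lean one can be computed.\<close>

lemma ptime_reencode: "ptime A enc enc' \<Longrightarrow> ptime A enc' g \<Longrightarrow> ptime A enc g"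
  using ptime_comp[of A enc enc' "\<lambda>a. a" A g] by blast

text \<open>A primitive is charged for its input and its output, so the point is that none enlarges
  its argument by more than a constant.\<close>

lemma ptime_prim: "ptime A enc (\<lambda>a. apply_prim f (enc a))"
proof (rule ptimeI)
  show "poly_time_realizes (Prim f) A enc (\<lambda>a y. y = apply_prim f (enc a))"
  proof -
    obtain c where c: "\<And>x. vsize (apply_prim f x) \<le> vsize x + c"
    proof (cases f)
      case (Const v)
      then show ?thesis using that[of "vsize v"] by simp
    next
      case Add
      \<comment> \<open>Both lengths are already contained in the size of the argument, so this
        crude bound for the sum suffices.\<close>
      have *: "floorlog 2 (m + n) \<le> floorlog 2 m + floorlog 2 n + 1" for m n
      proof (rule floorlog_leI)
        have "m < 2 ^ floorlog 2 m" "n < 2 ^ floorlog 2 n"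
          by (auto intro: floorlog_leD)
        moreover have "(2::nat) ^ floorlog 2 m \<le> 2 ^ (floorlog 2 m + floorlog 2 n)"
          "(2::nat) ^ floorlog 2 n \<le> 2 ^ (floorlog 2 m + floorlog 2 n)"
          by (intro power_increasing; simp)+
        ultimately have "m + n < 2 * 2 ^ (floorlog 2 m + floorlog 2 n)" by linarith
        then show "m + n < 2 ^ (floorlog 2 m + floorlog 2 n + 1)" by simp
      qed auto
      have "vsize (apply_prim Add x) \<le> vsize x + 1" for x
      proof (induction Add x rule: apply_prim.induct)
        case (5 m n)
        then show ?case using *[of m n] by simp
      qed (simp_all add: floorlog_eq_zero_iff[THEN iffD2])
      then show ?thesis using that Add by blast
    next
      case Sub
      have *: "floorlog 2 (m - n) \<le> floorlog 2 m" for m n :: nat by (simp add: floorlog_mono)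
      have "vsize (apply_prim Sub x) \<le> vsize x + 1" for x
      proof (induction Sub x rule: apply_prim.induct)
        case (6 m n)
        then show ?case using *[of m n] by simp
      qed (simp_all add: floorlog_eq_zero_iff[THEN iffD2])
      then show ?thesis using that Sub by blast
    next
      case Ident
      then show ?thesis using that[of 0] by simp
    next
      case First
      have "vsize (apply_prim First x) \<le> vsize x + 0" for x by (cases x) (auto simp: floorlog_def)
      then show ?thesis using that First by blast
    next
      case Second
      have "vsize (apply_prim Second x) \<le> vsize x + 0" for x by (cases x) (auto simp: floorlog_def)
      then show ?thesis using that Second by blast
    qed
    have "\<forall>a\<in>A. \<exists>t y. exec (Prim f) (enc a) t y \<and> t \<le> vsize (enc a) + (vsize (enc a) + c) \<and>
        y = apply_prim f (enc a)"
      using c exec.Prim by (meson add_left_mono)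
    then show ?thesis
      unfolding realizes_iff
      by (intro exI[of _ "\<lambda>a. vsize (enc a) + (vsize (enc a) + c)"] conjI
          poly_bounded_add poly_bounded_const poly_bounded_self)
  qed
qed

lemma ptime_apply: "ptime A enc f \<Longrightarrow> ptime A enc (\<lambda>a. apply_prim q (f a))"
  using ptime_comp[of A enc "\<lambda>y. y" f "f ` A" "apply_prim q", OF _ ptime_prim] by blast

lemma ptime_const: "ptime A enc (\<lambda>_. c)"
  using ptime_prim[of A enc "Const c"] by simp

lemma ptime_enc: "ptime A enc enc"
  using ptime_prim[of A enc Ident] by simp

lemma ptime_Cell:
  assumes "ptime A enc f" "ptime A enc g"
  shows "ptime A enc (\<lambda>a. Cell (f a) (g a))"
proof -
  obtain p q where "poly_time_realizes p A enc (\<lambda>a y. y = f a)"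
    "poly_time_realizes q A enc (\<lambda>a y. y = g a)"
    using assms unfolding ptime_def by blast
  from realizes_Both[OF this] have "poly_time_realizes (Both p q) A enc (\<lambda>a y. y = Cell (f a) (g a))"
    by (rule realizes_mono) simp
  then show ?thesis by (rule ptimeI)
qed

lemma ptime_First: "ptime A enc (\<lambda>a. Cell (f a) (g a)) \<Longrightarrow> ptime A enc f"
  using ptime_apply[of A enc "\<lambda>a. Cell (f a) (g a)" First] by simp

lemma ptime_Second: "ptime A enc (\<lambda>a. Cell (f a) (g a)) \<Longrightarrow> ptime A enc g"
  using ptime_apply[of A enc "\<lambda>a. Cell (f a) (g a)" Second] by simp

lemma ptime_add:
  "ptime A enc (\<lambda>a. Num (u a)) \<Longrightarrow> ptime A enc (\<lambda>a. Num (v a)) \<Longrightarrow> ptime A enc (\<lambda>a. Num (u a + v a))"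
  using ptime_apply[OF ptime_Cell, of A enc "\<lambda>a. Num (u a)" "\<lambda>a. Num (v a)" Add] by simp

lemma ptime_diff:
  "ptime A enc (\<lambda>a. Num (u a)) \<Longrightarrow> ptime A enc (\<lambda>a. Num (v a)) \<Longrightarrow> ptime A enc (\<lambda>a. Num (u a - v a))"
  using ptime_apply[OF ptime_Cell, of A enc "\<lambda>a. Num (u a)" "\<lambda>a. Num (v a)" Sub] by simp

lemma ptime_if_val:
  assumes b: "ptime A enc b" and p: "ptime {a \<in> A. b a \<noteq> Num 0} enc f"
    and q: "ptime {a \<in> A. b a = Num 0} enc g"
  shows "ptime A enc (\<lambda>a. if b a \<noteq> Num 0 then f a else g a)"
proof -
  obtain B P Q where B: "poly_time_realizes B A enc (\<lambda>a y. y = b a)"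
    and P: "poly_time_realizes P {a \<in> A. b a \<noteq> Num 0} enc (\<lambda>a y. y = f a)"
    and Q: "poly_time_realizes Q {a \<in> A. b a = Num 0} enc (\<lambda>a y. y = g a)"
    using assms unfolding ptime_def by blast
  have "poly_time_realizes (Cond B P Q) A enc (\<lambda>a y. y = (if b a \<noteq> Num 0 then f a else g a))"
  proof (rule realizes_Cond)
    show "poly_time_realizes B A enc (\<lambda>a y. (y \<noteq> Num 0) = (b a \<noteq> Num 0))"
      using B by (rule realizes_mono) simp
    show "poly_time_realizes P {a \<in> A. b a \<noteq> Num 0} enc
        (\<lambda>a y. y = (if b a \<noteq> Num 0 then f a else g a))"
      using P by (rule realizes_mono) simp
    have "poly_time_realizes Q {a \<in> A. b a = Num 0} enc
        (\<lambda>a y. y = (if b a \<noteq> Num 0 then f a else g a))"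
      using Q by (rule realizes_mono) simp
    then show "poly_time_realizes Q {a \<in> A. \<not> b a \<noteq> Num 0} enc
        (\<lambda>a y. y = (if b a \<noteq> Num 0 then f a else g a))" by simp
  qed
  then show ?thesis by (rule ptimeI)
qed

abbreviation Bool :: "bool \<Rightarrow> val" where
  "Bool b \<equiv> Num (of_bool b)"

lemma ptime_if:
  assumes "ptime A enc (\<lambda>a. Bool (P a))" "ptime {a \<in> A. P a} enc f" "ptime {a \<in> A. \<not> P a} enc g"
  shows "ptime A enc (\<lambda>a. if P a then f a else g a)"
  using ptime_if_val[OF assms(1), of f g] assms(2,3) by simp

lemma ptime_if_total:
  assumes "ptime A enc (\<lambda>a. Bool (P a))" "ptime A enc f" "ptime A enc g"
  shows "ptime A enc (\<lambda>a. if P a then f a else g a)"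
  by (rule ptime_if[OF assms(1)]) (auto intro: ptime_subset assms)

lemma ptime_nonzero:
  assumes "ptime A enc f"
  shows "ptime A enc (\<lambda>a. Bool (f a \<noteq> Num 0))"
  by (rule ptime_cong[OF ptime_if_val[OF assms ptime_const[of _ _ "Num 1"] ptime_const[of _ _ "Num 0"]]]) auto

lemma ptime_not:
  assumes "ptime A enc (\<lambda>a. Bool (P a))"
  shows "ptime A enc (\<lambda>a. Bool (\<not> P a))"
  by (rule ptime_cong[OF ptime_if_total[OF assms ptime_const[of _ _ "Num 0"] ptime_const[of _ _ "Num 1"]]]) auto

lemma ptime_and:
  assumes "ptime A enc (\<lambda>a. Bool (P a))" "ptime A enc (\<lambda>a. Bool (Q a))"
  shows "ptime A enc (\<lambda>a. Bool (P a \<and> Q a))"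
  by (rule ptime_cong[OF ptime_if_total[OF assms(1) assms(2) ptime_const[of _ _ "Num 0"]]]) auto

lemma ptime_or:
  assumes "ptime A enc (\<lambda>a. Bool (P a))" "ptime A enc (\<lambda>a. Bool (Q a))"
  shows "ptime A enc (\<lambda>a. Bool (P a \<or> Q a))"
  by (rule ptime_cong[OF ptime_if_total[OF assms(1) ptime_const[of _ _ "Num 1"] assms(2)]]) auto

text \<open>Truncated subtraction decides the order: \<open>v a - u a\<close> is nonzero exactly if
  \<open>u a < v a\<close>.\<close>

lemma ptime_less:
  assumes "ptime A enc (\<lambda>a. Num (u a))" "ptime A enc (\<lambda>a. Num (v a))"
  shows "ptime A enc (\<lambda>a. Bool (u a < v a))"
  by (rule ptime_cong[OF ptime_nonzero[OF ptime_diff[OF assms(2,1)]]]) auto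

lemma ptime_eq:
  assumes "ptime A enc (\<lambda>a. Num (u a))" "ptime A enc (\<lambda>a. Num (v a))"
  shows "ptime A enc (\<lambda>a. Bool (u a = v a))"
proof -
  have "ptime A enc (\<lambda>a. Bool (\<not> (u a < v a) \<and> \<not> (v a < u a)))"
    by (intro ptime_and ptime_not ptime_less assms)
  then show ?thesis by (rule ptime_cong) (auto simp: not_less)
qed


section \<open>Bounded loops\<close>

lemma enc_list_simps [simp]:
  "enc_list [] = Num 0" "enc_list (x # xs) = Cell x (enc_list xs)"
  by (simp_all add: enc_list_def)

lemma enc_list_eq_0_iff [simp]: "enc_list xs = Num 0 \<longleftrightarrow> xs = []"
  by (cases xs) auto

lemma length_le_vsize: "length xs \<le> vsize (enc_list xs)"
  by (induction xs) auto

lemma vsize_enc_list_drop: "vsize (enc_list (drop i xs)) \<le> vsize (enc_list xs)"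
proof (induction xs arbitrary: i)
  case (Cons x xs)
  then show ?case by (cases i) (simp_all add: le_SucI trans_le_add2)
qed simp

lemma vsize_enc_list_le: "\<forall>x\<in>set xs. vsize x \<le> c \<Longrightarrow> vsize (enc_list xs) \<le> length xs * (c + 1) + 1"
  by (induction xs) (auto simp: floorlog_def)

lemma vsize_Num_le: "vsize (Num i) \<le> i + 1"
proof -
  have "i < 2 ^ i" by (rule less_exp)
  then show ?thesis by (simp add: floorlog_leI)
qed

definition enc_idx :: "('a \<Rightarrow> val) \<Rightarrow> 'a \<times> nat \<Rightarrow> val" where
  "enc_idx enc x = Cell (enc (fst x)) (Num (snd x))"

text \<open>Input, index and accumulator of a loop. The accumulator is always the value of a
  function \<open>F\<close> of the other two, so that a loop is given by a recurrence for
  \<open>F\<close> and no separate invariant is carried along.\<close>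

definition enc_loop :: "('a \<Rightarrow> val) \<Rightarrow> ('a \<Rightarrow> nat \<Rightarrow> val) \<Rightarrow> 'a \<times> nat \<Rightarrow> val" where
  "enc_loop enc F x = Cell (enc (fst x)) (Cell (Num (snd x)) (F (fst x) (snd x)))"

abbreviation idx :: "'a set \<Rightarrow> ('a \<Rightarrow> nat) \<Rightarrow> ('a \<times> nat) set" where
  "idx A n \<equiv> SIGMA a:A. {..<n a}"

text \<open>A loop bound has to be available as the length of a list. The binary number n has size
  about log n, so n rounds could be exponentially many.\<close>

definition counts :: "'a set \<Rightarrow> ('a \<Rightarrow> val) \<Rightarrow> ('a \<Rightarrow> nat) \<Rightarrow> bool" where
  "counts A enc n \<longleftrightarrow> (\<exists>xs. ptime A enc (\<lambda>a. enc_list (xs a)) \<and> (\<forall>a\<in>A. length (xs a) = n a))"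

lemma countsI: "ptime A enc (\<lambda>a. enc_list (xs a)) \<Longrightarrow> (\<And>a. a \<in> A \<Longrightarrow> length (xs a) = n a) \<Longrightarrow> counts A enc n"
  unfolding counts_def by blast

lemma ptime_idx_enc: "ptime D (enc_idx enc) (\<lambda>x. enc (fst x))"
  and ptime_idx_snd: "ptime D (enc_idx enc) (\<lambda>x. Num (snd x))"
proof -
  have "ptime D (enc_idx enc) (\<lambda>x. Cell (enc (fst x)) (Num (snd x)))"
    by (rule ptime_cong[OF ptime_enc]) (auto simp: enc_idx_def)
  from ptime_First[OF this] ptime_Second[OF this]
  show "ptime D (enc_idx enc) (\<lambda>x. enc (fst x))" "ptime D (enc_idx enc) (\<lambda>x. Num (snd x))" .
qed

lemma ptime_idx_fst:
  "ptime A enc f \<Longrightarrow> ptime (idx A n) (enc_idx enc) (\<lambda>x. f (fst x))"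
  by (rule ptime_comp[where h = fst, OF ptime_idx_enc]) auto

lemma counts_idx: "counts A enc n \<Longrightarrow> counts (idx A m) (enc_idx enc) (\<lambda>x. n (fst x))"
  unfolding counts_def using ptime_idx_fst[of A enc] by (fastforce simp: Sigma_def)

lemma ptime_loop_idx: "ptime D (enc_loop enc F) (enc_idx enc)"
  and ptime_loop_acc: "ptime D (enc_loop enc F) (\<lambda>x. F (fst x) (snd x))"
proof -
  have 0: "ptime D (enc_loop enc F)
      (\<lambda>x. Cell (enc (fst x)) (Cell (Num (snd x)) (F (fst x) (snd x))))"
    by (rule ptime_cong[OF ptime_enc]) (auto simp: enc_loop_def)
  note 1 = ptime_First[OF 0] and 2 = ptime_First[OF ptime_Second[OF 0]]
  show "ptime D (enc_loop enc F) (enc_idx enc)"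
    using ptime_Cell[OF 1 2] by (simp add: enc_idx_def[abs_def])
  show "ptime D (enc_loop enc F) (\<lambda>x. F (fst x) (snd x))"
    using ptime_Second[OF ptime_Second[OF 0]] .
qed

lemmas ptime_loop = ptime_reencode[OF ptime_loop_idx]

text \<open>The loop state holds, besides index and accumulator, the unconsumed rest of the counting
  list. It loses one entry per round and the loop stops when it is empty. What remains to be
  supplied is one step of the recurrence and a size bound for all values of \<open>F\<close> up to
  the last one.\<close>

lemma ptime_for:
  assumes n: "counts A enc n" and init: "ptime A enc (\<lambda>a. F a 0)"
    and body: "ptime (idx A n) (enc_loop enc F) (\<lambda>x. F (fst x) (Suc (snd x)))"
    and size: "poly_bounded (SIGMA a:A. {..n a}) (\<lambda>x. vsize (enc (fst x)))
      (\<lambda>x. vsize (F (fst x) (snd x)))"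
  shows "ptime A enc (\<lambda>a. F a (n a))"
proof -
  obtain xs where xs: "ptime A enc (\<lambda>a. enc_list (xs a))" "\<And>a. a \<in> A \<Longrightarrow> length (xs a) = n a"
    using n unfolding counts_def by blast
  define e where "e x = Cell (enc (fst x)) (Cell (enc_list (drop (snd x) (xs (fst x))))
    (Cell (Num (snd x)) (F (fst x) (snd x))))" for x
  define D where "D = (SIGMA a:A. {..n a})"
  define P where "P x \<longleftrightarrow> snd x < n (fst x)" for x :: "'a \<times> nat"
  define step where "step x y \<longleftrightarrow> fst y = fst x \<and> snd y = Suc (snd x)" for x y :: "'a \<times> nat"
  have e: "ptime D' e e" for D' by (rule ptime_enc)
  have e0: "ptime D' e (\<lambda>x. enc (fst x))" for D'
    using ptime_First[OF e[unfolded e_def[abs_def]]] by (simp add: e_def[abs_def])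
  have e1: "ptime D' e (\<lambda>x. enc_list (drop (snd x) (xs (fst x))))" for D'
    using ptime_First[OF ptime_Second[OF e[unfolded e_def[abs_def]]]] by (simp add: e_def[abs_def])
  have e2: "ptime D' e (\<lambda>x. Num (snd x))" for D'
    using ptime_First[OF ptime_Second[OF ptime_Second[OF e[unfolded e_def[abs_def]]]]]
    by (simp add: e_def[abs_def])
  have e3: "ptime D' e (\<lambda>x. F (fst x) (snd x))" for D'
    using ptime_Second[OF ptime_Second[OF ptime_Second[OF e[unfolded e_def[abs_def]]]]]
    by (simp add: e_def[abs_def])
  have idx: "{x \<in> D. P x} = idx A n" by (auto simp: D_def P_def)
  obtain t where "poly_time_realizes t D e (\<lambda>x y. y = enc_list (drop (snd x) (xs (fst x))))"
    using e1 unfolding ptime_def by blast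
  then have t: "poly_time_realizes t D e (\<lambda>x y. y \<noteq> Num 0 \<longleftrightarrow> P x)"
    by (rule realizes_mono) (auto simp: D_def P_def xs(2))
  have "ptime (idx A n) e (\<lambda>x. e (fst x, Suc (snd x)))"
  proof -
    have "ptime (idx A n) e (enc_loop enc F)"
      unfolding enc_loop_def[abs_def] by (intro ptime_Cell e0 e2 e3)
    from ptime_reencode[OF this body]
    have F: "ptime (idx A n) e (\<lambda>x. F (fst x) (Suc (snd x)))" .
    have "ptime (idx A n) e (\<lambda>x. apply_prim Second (enc_list (drop (snd x) (xs (fst x)))))"
      by (rule ptime_apply[OF e1])
    then have l: "ptime (idx A n) e (\<lambda>x. enc_list (drop (Suc (snd x)) (xs (fst x))))"
      by (rule ptime_cong) (auto simp: xs(2) Cons_nth_drop_Suc[symmetric])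
    have "ptime (idx A n) e (\<lambda>x. Num (snd x + 1))"
      by (intro ptime_add e2 ptime_const)
    then have "ptime (idx A n) e (\<lambda>x. Num (Suc (snd x)))" by simp
    then show ?thesis unfolding e_def fst_conv snd_conv
      using ptime_Cell[OF e0 ptime_Cell[OF l ptime_Cell[OF _ F]]] by (simp add: e_def[abs_def])
  qed
  then obtain b where "poly_time_realizes b {x \<in> D. P x} e (\<lambda>x y. y = e (fst x, Suc (snd x)))"
    unfolding ptime_def idx by blast
  then have b: "poly_time_realizes b {x \<in> D. P x} e (\<lambda>x y. \<exists>x'\<in>D. y = e x' \<and> step x x' \<and> x' \<in> D)"
    by (rule realizes_mono) (force simp: D_def P_def step_def)
  \<comment> \<open>\<open>step\<close> alone increments the index forever and would leave
    \<open>D\<close>, outside of which the size of \<open>F\<close> is not controlled. Reachable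
    states are therefore confined to \<open>D\<close>.\<close>
  define step' where "step' x x' \<longleftrightarrow> step x x' \<and> x' \<in> D" for x x'
  have steps: "fst x' = fst x \<and> (x \<in> D \<longrightarrow> x' \<in> D)" if "step'\<^sup>*\<^sup>* x x'" for x x'
    using that by induction (auto simp: step_def step'_def)
  have "poly_bounded {(x, x'). x \<in> D \<and> step'\<^sup>*\<^sup>* x x'} (\<lambda>x. vsize (e (fst x)))
    (\<lambda>x. vsize (e (snd x)))"
  proof (rule poly_bounded_mono)
    let ?X = "{(x, x'). x \<in> D \<and> step'\<^sup>*\<^sup>* x x'}"
    have 1: "poly_bounded ?X (\<lambda>x. vsize (e (fst x))) (\<lambda>x. f (fst (fst x)))"
      if "poly_bounded A (\<lambda>a. vsize (enc a)) f" for f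
      by (rule poly_bounded_comp[where h = "\<lambda>x. fst (fst x)", OF that poly_bounded_self])
        (auto simp: D_def e_def)
    have 2: "poly_bounded ?X (\<lambda>x. vsize (e (fst x)))
        ((\<lambda>x. vsize (F (fst x) (snd x))) \<circ> snd)"
      unfolding o_def
      by (rule poly_bounded_comp[where h = snd, OF size poly_bounded_self])
        (use steps in \<open>force simp: D_def e_def\<close>)+
    show "poly_bounded ?X (\<lambda>x. vsize (e (fst x)))
      (\<lambda>x. vsize (enc (fst (fst x))) + vsize (enc_list (xs (fst (fst x)))) +
        vsize (enc_list (xs (fst (fst x)))) +
        ((\<lambda>x. vsize (F (fst x) (snd x))) \<circ> snd) x + 4)"
      by (intro poly_bounded_add poly_bounded_const 2 1[OF ptime_vsize[OF ptime_enc]]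
          1[OF ptime_vsize[OF xs(1)]])
    fix x assume "x \<in> ?X"
    then have x: "fst (snd x) = fst (fst x)" "snd x \<in> D" using steps by auto
    then have "snd (snd x) \<le> length (xs (fst (fst x)))" by (auto simp: D_def xs(2))
    with length_le_vsize[of "xs (fst (fst x))"] vsize_Num_le[of "snd (snd x)"]
    have "vsize (Num (snd (snd x))) \<le> vsize (enc_list (xs (fst (fst x)))) + 1" by linarith
    then show "vsize (e (snd x)) \<le> vsize (enc (fst (fst x))) + vsize (enc_list (xs (fst (fst x)))) +
        vsize (enc_list (xs (fst (fst x)))) +
        ((\<lambda>x. vsize (F (fst x) (snd x))) \<circ> snd) x + 4"
      using vsize_enc_list_drop[of "snd (snd x)" "xs (fst (fst x))"]
      by (simp add: e_def x(1))
  qed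
  moreover have "poly_bounded D (\<lambda>x. vsize (e x)) (\<lambda>x. n (fst x) - snd x)"
  proof (rule poly_bounded_mono)
    show "poly_bounded D (\<lambda>x. vsize (e x)) (\<lambda>x. vsize (enc_list (xs (fst x))))"
      by (rule poly_bounded_comp[where h = fst, OF ptime_vsize[OF xs(1)] poly_bounded_self])
        (auto simp: D_def e_def)
    show "n (fst x) - snd x \<le> vsize (enc_list (xs (fst x)))" if "x \<in> D" for x
      using length_le_vsize[of "xs (fst x)"] that by (auto simp: D_def xs(2))
  qed
  ultimately have loop: "poly_time_realizes (While t b) D e
      (\<lambda>x y. \<exists>x'\<in>D. y = e x' \<and> step'\<^sup>*\<^sup>* x x' \<and> \<not> P x')"
    using b unfolding step'_def[symmetric]
    by (intro realizes_While[OF t, where M = "\<lambda>x. n (fst x) - snd x"])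
      (auto simp: step'_def step_def P_def)
  have "ptime A enc (\<lambda>a. e (a, 0))"
    unfolding e_def fst_conv snd_conv drop_0 by (intro ptime_Cell ptime_enc xs(1) ptime_const init)
  then obtain i where i: "poly_time_realizes i A enc (\<lambda>a y. y = e (a, 0))"
    unfolding ptime_def by blast
  have "poly_time_realizes (Seq i (While t b)) A enc
      (\<lambda>a z. \<exists>x\<in>D. x = (a, 0) \<and> (\<exists>x'\<in>D. z = e x' \<and> step'\<^sup>*\<^sup>* x x' \<and> \<not> P x'))"
    by (rule realizes_Seq[OF i loop]) (auto simp: D_def)
  then have "poly_time_realizes (Seq i (While t b)) A enc (\<lambda>a z. z = e (a, n a))"
  proof (rule realizes_mono)
    fix a z assume "\<exists>x\<in>D. x = (a, 0) \<and> (\<exists>x'\<in>D. z = e x' \<and> step'\<^sup>*\<^sup>* x x' \<and> \<not> P x')"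
    then obtain x' where "x' \<in> D" "z = e x'" "step'\<^sup>*\<^sup>* (a, 0) x'" "\<not> P x'" by blast
    moreover from this have "x' = (a, n a)"
      using steps by (cases x') (force simp: D_def P_def)
    ultimately show "z = e (a, n a)" by simp
  qed
  then have "ptime A enc (\<lambda>a. e (a, n a))" by (rule ptimeI)
  then have "ptime A enc (\<lambda>a. Cell (enc a) (Cell (enc_list (drop (n a) (xs a)))
      (Cell (Num (n a)) (F a (n a)))))"
    unfolding e_def fst_conv snd_conv .
  from ptime_Second[OF ptime_Second[OF ptime_Second[OF this]]] show ?thesis .
qed

section \<open>Counting, sums, lists and searches as loops\<close>

lemma ptime_count: "counts A enc n \<Longrightarrow> ptime A enc (\<lambda>a. Num (n a))"
proof (rule ptime_for[where F = "\<lambda>_. Num"])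
  assume n: "counts A enc n"
  have "ptime (idx A n) (enc_loop enc (\<lambda>_. Num)) (\<lambda>x. Num (snd x + 1))"
    by (intro ptime_add ptime_const ptime_loop ptime_idx_snd)
  then show "ptime (idx A n) (enc_loop enc (\<lambda>_. Num)) (\<lambda>x. Num (Suc (snd x)))" by simp
  obtain xs where xs: "ptime A enc (\<lambda>a. enc_list (xs a))" "\<And>a. a \<in> A \<Longrightarrow> length (xs a) = n a"
    using n unfolding counts_def by blast
  show "poly_bounded (SIGMA a:A. {..n a}) (\<lambda>x. vsize (enc (fst x))) (\<lambda>x. vsize (Num (snd x)))"
  proof (rule poly_bounded_mono)
    show "poly_bounded (SIGMA a:A. {..n a}) (\<lambda>x. vsize (enc (fst x)))
        (\<lambda>x. vsize (enc_list (xs (fst x))) + 1)"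
      by (intro poly_bounded_add poly_bounded_const
          poly_bounded_comp[where h = fst, OF ptime_vsize[OF xs(1)] poly_bounded_self]) auto
    fix x assume "x \<in> (SIGMA a:A. {..n a})"
    then have "snd x \<le> length (xs (fst x))" by (auto simp: xs(2))
    then show "vsize (Num (snd x)) \<le> vsize (enc_list (xs (fst x))) + 1"
      using length_le_vsize[of "xs (fst x)"] vsize_Num_le[of "snd x"] by linarith
  qed
qed (auto intro: ptime_const)

lemma counts_poly_bounded:
  assumes "counts A enc n"
  shows "poly_bounded A (\<lambda>a. vsize (enc a)) n"
proof -
  obtain xs where xs: "ptime A enc (\<lambda>a. enc_list (xs a))" "\<And>a. a \<in> A \<Longrightarrow> length (xs a) = n a"
    using assms unfolding counts_def by blast
  show ?thesis
    using ptime_vsize[OF xs(1)] by (rule poly_bounded_mono) (metis length_le_vsize xs(2))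
qed

text \<open>Indices below \<open>n a\<close> have size polynomial in that of \<open>a\<close>, so a
  bound in terms of the pair yields one in terms of \<open>a\<close> alone, uniform over all
  rounds.\<close>

lemma ptime_idx_bound:
  assumes n: "counts A enc n" and f: "ptime (idx A n) (enc_idx enc) (\<lambda>x. f (fst x) (snd x))"
  obtains c where "poly_bounded A (\<lambda>a. vsize (enc a)) c"
    "\<And>a i. a \<in> A \<Longrightarrow> i < n a \<Longrightarrow> vsize (f a i) \<le> c a"
proof -
  obtain b :: "nat poly" where b:
    "\<And>x. x \<in> idx A n \<Longrightarrow> vsize (f (fst x) (snd x)) \<le> poly b (vsize (enc_idx enc x))"
    using ptime_vsize[OF f] unfolding poly_bounded_def by blast
  show thesis
  proof
    show "poly_bounded A (\<lambda>a. vsize (enc a)) (\<lambda>a. poly b (vsize (enc a) + n a + 2))"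
      by (rule poly_bounded_comp[OF poly_bounded_poly, where B = UNIV and m' = "\<lambda>x. x" and h = "\<lambda>a. vsize (enc a) + n a + 2"
            and g = "\<lambda>a. vsize (enc a) + n a + 2"])
        (intro poly_bounded_add poly_bounded_const poly_bounded_self counts_poly_bounded[OF n] | simp)+
    fix a i assume ai: "a \<in> A" "i < n a"
    have "vsize (f a i) \<le> poly b (vsize (enc_idx enc (a, i)))" using b[of "(a, i)"] ai by simp
    also have "\<dots> \<le> poly b (vsize (enc a) + n a + 2)"
      using vsize_Num_le[of i] ai by (intro poly_mono_nat) (simp add: enc_idx_def)
    finally show "vsize (f a i) \<le> poly b (vsize (enc a) + n a + 2)" .
  qed
qed

lemma poly_bounded_fst:
  "poly_bounded A m f \<Longrightarrow> poly_bounded (Sigma A N) (\<lambda>x. m (fst x)) (\<lambda>x. f (fst x))"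
  by (rule poly_bounded_comp[where h = fst, OF _ poly_bounded_self]) auto

lemma ptime_sum:
  fixes f :: "'a \<Rightarrow> nat \<Rightarrow> nat"
  assumes n: "counts A enc n" and f: "ptime (idx A n) (enc_idx enc) (\<lambda>x. Num (f (fst x) (snd x)))"
  shows "ptime A enc (\<lambda>a. Num (\<Sum>i<n a. f a i))"
proof (rule ptime_for[OF n, where F = "\<lambda>a i. Num (\<Sum>j<i. f a j)"])
  show "ptime (idx A n) (enc_loop enc (\<lambda>a i. Num (\<Sum>j<i. f a j)))
      (\<lambda>x. Num (\<Sum>j<Suc (snd x). f (fst x) j))"
    unfolding sum.lessThan_Suc
    by (intro ptime_add ptime_loop f ptime_loop_acc)
  obtain c where c: "poly_bounded A (\<lambda>a. vsize (enc a)) c"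
    "\<And>a i. a \<in> A \<Longrightarrow> i < n a \<Longrightarrow> vsize (Num (f a i)) \<le> c a"
    using ptime_idx_bound[OF n, of "\<lambda>a i. Num (f a i)"] f by blast
  show "poly_bounded (SIGMA a:A. {..n a}) (\<lambda>x. vsize (enc (fst x)))
      (\<lambda>x. vsize (Num (\<Sum>j<snd x. f (fst x) j)))"
  proof (rule poly_bounded_mono)
    show "poly_bounded (SIGMA a:A. {..n a}) (\<lambda>x. vsize (enc (fst x))) (\<lambda>x. n (fst x) + c (fst x) + 1)"
      by (intro poly_bounded_add poly_bounded_const poly_bounded_fst c(1) counts_poly_bounded[OF n])
    fix x assume "x \<in> (SIGMA a:A. {..n a})"
    then obtain a i where x: "x = (a, i)" "a \<in> A" "i \<le> n a" by blast
    have "f a j < 2 ^ c a" if "j < i" for j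
    proof -
      have "floorlog 2 (f a j) \<le> c a" using c(2)[of a j] that x by simp
      then show ?thesis by (rule floorlog_leD) simp
    qed
    \<comment> \<open>At most \<open>n a\<close> terms below \<open>2 ^ c a\<close> stay below
      \<open>2 ^ (n a + c a)\<close>, so every partial sum has at most \<open>n a + c a\<close>
      bits.\<close>
    then have "(\<Sum>j<i. f a j) \<le> (\<Sum>j<i. 2 ^ c a)" by (intro sum_mono less_imp_le) auto
    also have "\<dots> \<le> n a * 2 ^ c a" using x(3) by simp
    also have "\<dots> < 2 ^ n a * 2 ^ c a" using less_exp[of "n a"] by simp
    finally have "(\<Sum>j<i. f a j) < 2 ^ (n a + c a)" by (simp add: power_add)
    then have "floorlog 2 (\<Sum>j<i. f a j) \<le> n a + c a" by (intro floorlog_leI) auto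
    then show "vsize (Num (\<Sum>j<snd x. f (fst x) j)) \<le> n (fst x) + c (fst x) + 1" using x by simp
  qed
qed (simp add: ptime_const)

text \<open>The truth values are added up, and the sum is tested for zero.\<close>

lemma ptime_ex:
  assumes n: "counts A enc n" and P: "ptime (idx A n) (enc_idx enc) (\<lambda>x. Bool (P (fst x) (snd x)))"
  shows "ptime A enc (\<lambda>a. Bool (\<exists>i<n a. P a i))"
  by (rule ptime_cong[OF ptime_nonzero[OF ptime_sum[OF assms]]]) auto

lemma ptime_map:
  assumes n: "counts A enc n" and f: "ptime (idx A n) (enc_idx enc) (\<lambda>x. f (fst x) (snd x))"
  shows "ptime A enc (\<lambda>a. enc_list (map (f a) [0..<n a]))"
proof -
  \<comment> \<open>\<open>Cell\<close> extends a list at the front, so the list is built from its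
    end: after \<open>j\<close> rounds the last \<open>j\<close> entries are there.\<close>
  define F where "F a j = enc_list (map (f a) [n a - j..<n a])" for a j
  have "ptime A enc (\<lambda>a. F a (n a))"
  proof (rule ptime_for[OF n, where F = F])
    show "ptime A enc (\<lambda>a. F a 0)" by (simp add: F_def ptime_const)
    have "ptime (idx A n) (enc_idx enc) (\<lambda>x. enc_idx enc (fst x, n (fst x) - (snd x + 1)))"
      unfolding enc_idx_def[of enc "(_, _)"] fst_conv snd_conv
      by (intro ptime_Cell ptime_diff ptime_add ptime_idx_enc ptime_idx_snd ptime_const
          ptime_idx_fst[OF ptime_count[OF n]])
    then have "ptime (idx A n) (enc_idx enc) (\<lambda>x. f (fst x) (n (fst x) - (snd x + 1)))"
      by (rule ptime_comp[OF _ f, where h = "\<lambda>x. (fst x, n (fst x) - (snd x + 1))",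
          unfolded fst_conv snd_conv]) auto
    then have "ptime (idx A n) (enc_loop enc F)
        (\<lambda>x. Cell (f (fst x) (n (fst x) - (snd x + 1))) (F (fst x) (snd x)))"
      by (intro ptime_Cell ptime_loop_acc ptime_loop)
    then show "ptime (idx A n) (enc_loop enc F) (\<lambda>x. F (fst x) (Suc (snd x)))"
      by (rule ptime_cong) (auto simp: F_def upt_conv_Cons[of "n _ - Suc _"] Suc_diff_Suc)
    obtain c where c: "poly_bounded A (\<lambda>a. vsize (enc a)) c"
      "\<And>a i. a \<in> A \<Longrightarrow> i < n a \<Longrightarrow> vsize (f a i) \<le> c a"
      using ptime_idx_bound[OF n f] by blast
    show "poly_bounded (SIGMA a:A. {..n a}) (\<lambda>x. vsize (enc (fst x)))
        (\<lambda>x. vsize (F (fst x) (snd x)))"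
    proof (rule poly_bounded_mono)
      show "poly_bounded (SIGMA a:A. {..n a}) (\<lambda>x. vsize (enc (fst x)))
          (\<lambda>x. n (fst x) * (c (fst x) + 1) + 1)"
        by (intro poly_bounded_add poly_bounded_mult poly_bounded_const poly_bounded_fst c(1)
            counts_poly_bounded[OF n])
      fix x assume "x \<in> (SIGMA a:A. {..n a})"
      then obtain a i where x: "x = (a, i)" "a \<in> A" "i \<le> n a" by blast
      have "vsize (F a i) \<le> length (map (f a) [n a - i..<n a]) * (c a + 1) + 1"
        unfolding F_def by (rule vsize_enc_list_le) (use x c(2) in auto)
      also have "\<dots> \<le> n a * (c a + 1) + 1" using x by (intro add_mono mult_mono) auto
      finally show "vsize (F (fst x) (snd x)) \<le> n (fst x) * (c (fst x) + 1) + 1" using x by simp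
    qed
  qed
  then show ?thesis by (simp add: F_def)
qed

lemma ptime_nth:
  assumes xs: "ptime A enc (\<lambda>a. enc_list (xs a))" and i: "ptime A enc (\<lambda>a. Num (i a))"
    and less: "\<And>a. a \<in> A \<Longrightarrow> i a < length (xs a)"
  shows "ptime A enc (\<lambda>a. xs a ! i a)"
proof -
  \<comment> \<open>The position is a binary number and cannot drive a loop. The loop runs over the
    list itself, and \<open>min\<close> stops the dropping once the position is reached.\<close>
  define F where "F a j = enc_list (drop (min j (i a)) (xs a))" for a j
  define n where "n a = length (xs a)" for a
  have n: "counts A enc n" using xs by (rule countsI) (simp add: n_def)
  have "ptime A enc (\<lambda>a. F a (n a))"
  proof (rule ptime_for[OF n, where F = F])
    show "ptime A enc (\<lambda>a. F a 0)" using xs by (simp add: F_def)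
    have "ptime (idx A n) (enc_loop enc F)
        (\<lambda>x. if snd x < i (fst x) then apply_prim Second (F (fst x) (snd x)) else F (fst x) (snd x))"
      by (intro ptime_if_total ptime_less ptime_apply ptime_loop_acc ptime_loop ptime_idx_snd
          ptime_idx_fst i)
    then show "ptime (idx A n) (enc_loop enc F) (\<lambda>x. F (fst x) (Suc (snd x)))"
      by (rule ptime_cong)
        (auto simp: F_def min_def n_def Cons_nth_drop_Suc[symmetric] not_less_eq_eq)
    show "poly_bounded (SIGMA a:A. {..n a}) (\<lambda>x. vsize (enc (fst x)))
        (\<lambda>x. vsize (F (fst x) (snd x)))"
      by (rule poly_bounded_mono[OF poly_bounded_fst[OF ptime_vsize[OF xs]]])
        (simp add: F_def vsize_enc_list_drop)
  qed
  then have "ptime A enc (\<lambda>a. Cell (xs a ! i a) (enc_list (drop (Suc (i a)) (xs a))))"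
    by (rule ptime_cong)
      (simp_all add: F_def n_def min_absorb2 less less_imp_le Cons_nth_drop_Suc[symmetric])
  then show ?thesis by (rule ptime_First)
qed

text \<open>A bounded search that returns the witness instead of a truth value, with
  \<open>Num 0\<close> standing for its absence.\<close>

primrec first_nonzero :: "(nat \<Rightarrow> val) \<Rightarrow> nat \<Rightarrow> val" where
  "first_nonzero f 0 = Num 0"
| "first_nonzero f (Suc i) = (if first_nonzero f i \<noteq> Num 0 then first_nonzero f i else f i)"

lemma first_nonzero_eq_0_iff: "first_nonzero f n = Num 0 \<longleftrightarrow> (\<forall>i<n. f i = Num 0)"
  by (induction n) (auto simp: less_Suc_eq)

lemma first_nonzero_cases: "first_nonzero f n = Num 0 \<or> (\<exists>i<n. first_nonzero f n = f i)"
  by (induction n) (auto simp: less_Suc_eq)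

lemma ptime_first_nonzero:
  assumes n: "counts A enc n" and f: "ptime (idx A n) (enc_idx enc) (\<lambda>x. f (fst x) (snd x))"
  shows "ptime A enc (\<lambda>a. first_nonzero (f a) (n a))"
proof (rule ptime_for[OF n, where F = "\<lambda>a. first_nonzero (f a)"])
  show "ptime (idx A n) (enc_loop enc (\<lambda>a. first_nonzero (f a)))
      (\<lambda>x. first_nonzero (f (fst x)) (Suc (snd x)))"
    unfolding first_nonzero.simps
    by (rule ptime_if_val)
      (auto intro: ptime_loop_acc ptime_subset[OF ptime_loop[OF f]])
  obtain c where c: "poly_bounded A (\<lambda>a. vsize (enc a)) c"
    "\<And>a i. a \<in> A \<Longrightarrow> i < n a \<Longrightarrow> vsize (f a i) \<le> c a"
    using ptime_idx_bound[OF n f] by blast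
  show "poly_bounded (SIGMA a:A. {..n a}) (\<lambda>x. vsize (enc (fst x)))
      (\<lambda>x. vsize (first_nonzero (f (fst x)) (snd x)))"
  proof (rule poly_bounded_mono)
    show "poly_bounded (SIGMA a:A. {..n a}) (\<lambda>x. vsize (enc (fst x))) (\<lambda>x. c (fst x) + 1)"
      by (intro poly_bounded_add poly_bounded_const poly_bounded_fst c(1))
    fix x assume "x \<in> (SIGMA a:A. {..n a})"
    then obtain a i where x: "x = (a, i)" "a \<in> A" "i \<le> n a" by blast
    from first_nonzero_cases[of "f a" i]
    show "vsize (first_nonzero (f (fst x)) (snd x)) \<le> c (fst x) + 1"
    proof
      assume "\<exists>j<i. first_nonzero (f a) i = f a j"
      then show ?thesis using c(2)[OF x(2)] x by (auto simp: le_SucI)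
    qed (simp add: x floorlog_def)
  qed
qed (simp add: ptime_const)


section \<open>Distances\<close>

text \<open>The distance is an infimum over walks in the extended reals. Walk lengths are integers,
  so a finite infimum is attained and a real bound is met by an actual walk.\<close>

lemma gdist_le_iff:
  assumes "pair_graph G"
  shows "gdist G u v \<le> ereal r \<longleftrightarrow>
    (\<exists>p. pre_digraph.awalk (with_proj G) u p v \<and> real (length p) \<le> r)"
proof -
  interpret pair_graph G by fact
  have cost: "awalk_cost (\<lambda>_. 1) p = real (length p)" for p :: "('a \<times> 'a) list"
    by (induction p) auto
  show ?thesis
  proof
    assume le: "gdist G u v \<le> ereal r"
    \<comment> \<open>A strict bound yields a walk; as its length is an integer below floor(r) + 1,
      it is at most floor(r).\<close>
    have "gdist G u v < ereal (of_int \<lfloor>r\<rfloor> + 1)"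
      using le by (rule le_less_trans) simp
    then obtain p where p: "awalk u p v" "real (length p) < of_int \<lfloor>r\<rfloor> + 1"
      unfolding gdist_def \<mu>_def by (auto simp: INF_less_iff cost)
    from p(2) have "int (length p) \<le> \<lfloor>r\<rfloor>" by linarith
    then have "real (length p) \<le> r" by linarith
    with p(1) show "\<exists>p. awalk u p v \<and> real (length p) \<le> r" by blast
  next
    assume "\<exists>p. awalk u p v \<and> real (length p) \<le> r"
    then obtain p where "awalk u p v" "real (length p) \<le> r" by blast
    then show "gdist G u v \<le> ereal r"
      using min_cost_le_walk_cost[of u p v "\<lambda>_. 1"] unfolding gdist_def
      by (metis cost ereal_less_eq(3) order_trans)
  qed
qed

lemma gdist_refl:
  assumes "pair_graph G" "v \<in> pverts G" "0 \<le> r"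
  shows "gdist G v v \<le> ereal r"
proof -
  interpret pair_graph G by fact
  show ?thesis
    unfolding gdist_le_iff[OF assms(1)] by (rule exI[of _ "[]"]) (use assms in \<open>simp add: awalk_Nil_iff\<close>)
qed

lemma gdist_sym:
  assumes "pair_graph G" "gdist G u v \<le> ereal r"
  shows "gdist G v u \<le> ereal r"
proof -
  interpret pair_graph G by fact
  obtain p where "awalk u p v" "real (length p) \<le> r"
    using assms by (auto simp: gdist_le_iff)
  moreover have "length (rev_path p) = length p" by (induction p) auto
  ultimately show ?thesis
    unfolding gdist_le_iff[OF assms(1)] by (intro exI[of _ "rev_path p"]) simp
qed

lemma gdist_triangle:
  assumes "pair_graph G" "gdist G u v \<le> ereal r" "gdist G v w \<le> ereal s"
  shows "gdist G u w \<le> ereal (r + s)"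
proof -
  interpret pair_graph G by fact
  obtain p q where "awalk u p v" "real (length p) \<le> r" "awalk v q w" "real (length q) \<le> s"
    using assms by (auto simp: gdist_le_iff)
  then show ?thesis
    unfolding gdist_le_iff[OF assms(1)] by (intro exI[of _ "p @ q"]) (auto intro: awalk_appendI)
qed

text \<open>Recursion on the radius with intermediate vertices ranging over an initial segment of
  the naturals, a form that bounded searches can evaluate.\<close>

primrec reach_within :: "nat pair_pre_digraph \<Rightarrow> nat \<Rightarrow> nat \<Rightarrow> nat \<Rightarrow> bool" where
  "reach_within G 0 u v \<longleftrightarrow> u = v"
| "reach_within G (Suc l) u v \<longleftrightarrow>
    reach_within G l u v \<or> (\<exists>w<card (pverts G). reach_within G l u w \<and> (w, v) \<in> parcs G)"

lemma reach_within_iff_gdist_le: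
  assumes G: "pair_graph G" "pverts G = {0..<n}" and u: "u < n"
  shows "reach_within G l u v \<longleftrightarrow> gdist G u v \<le> ereal (real l)"
proof -
  interpret pair_graph G by fact
  have "reach_within G l u v \<longleftrightarrow> (\<exists>p. awalk u p v \<and> length p \<le> l)"
  proof (induction l arbitrary: v)
    case 0
    \<comment> \<open>The empty walk exists only at a vertex, which is where \<open>u < n\<close>
      enters.\<close>
    then show ?case using u by (auto simp: awalk_Nil_iff G(2))
  next
    case (Suc l)
    show ?case
    proof
      assume "reach_within G (Suc l) u v"
      then consider "reach_within G l u v" | w where "reach_within G l u w" "(w, v) \<in> parcs G" by auto
      then show "\<exists>p. awalk u p v \<and> length p \<le> Suc l"
      proof cases
        case 1
        then show ?thesis using Suc.IH le_SucI by blast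
      next
        case 2
        then obtain p where p: "awalk u p w" "length p \<le> l" using Suc.IH by blast
        moreover have "awalk w [(w, v)] v" using 2(2) by (simp add: awalk_simps in_arcsD2)
        ultimately have "awalk u (p @ [(w, v)]) v" by (blast intro: awalk_appendI)
        then show ?thesis using p(2) by (intro exI[of _ "p @ [(w, v)]"]) simp
      qed
    next
      assume "\<exists>p. awalk u p v \<and> length p \<le> Suc l"
      then obtain p where p: "awalk u p v" "length p \<le> Suc l" by blast
      show "reach_within G (Suc l) u v"
      proof (cases p rule: rev_cases)
        case Nil
        then show ?thesis using p(1) Suc.IH[of v] by (auto intro: exI[of _ "[]"])
      next
        case (snoc q e)
        obtain w x where e: "e = (w, x)" by (cases e)
        obtain w' where "awalk u q w'" "awalk w' [(w, x)] v" using p(1) unfolding snoc e by auto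
        then have "awalk u q w" "awalk w [(w, x)] v" by (auto simp: awalk_simps)
        then have "x = v" "(w, v) \<in> parcs G" "w < n"
          using in_arcsD1[of w v] by (auto simp: awalk_simps G(2))
        moreover have "reach_within G l u w" using \<open>awalk u q w\<close> p(2) snoc Suc.IH by auto
        ultimately show ?thesis by (auto simp: G(2))
      qed
    qed
  qed
  then show ?thesis by (simp add: gdist_le_iff[OF G(1)])
qed


section \<open>Hall's theorem with capacities\<close>

text \<open>The Halmos-Vaughan induction. If some nonempty proper subset is tight, it and the rest
  are treated separately. Otherwise all such subsets have slack, and one element can be placed at
  any neighbor with positive capacity.\<close>

lemma hall_capacities:
  fixes c :: "'b \<Rightarrow> nat"
  assumes "finite X" "\<And>x. x \<in> X \<Longrightarrow> finite (N x)"
    and "\<And>A. A \<subseteq> X \<Longrightarrow> card A \<le> sum c (\<Union>(N ` A))"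
  shows "\<exists>f. (\<forall>x\<in>X. f x \<in> N x) \<and> (\<forall>y. card {x \<in> X. f x = y} \<le> c y)"
  using assms
proof (induction "card X" arbitrary: X c rule: less_induct)
  case less
  have fin: "finite (\<Union>(N ` A))" if "A \<subseteq> X" for A
    using that less.prems(1,2) by (auto dest: finite_subset)
  show ?case
  proof (cases "X = {}")
    case False
    show ?thesis
    proof (cases "\<exists>A. A \<noteq> {} \<and> A \<subset> X \<and> card A = sum c (\<Union>(N ` A))")
      case True
      then obtain A where A: "A \<noteq> {}" "A \<subset> X" "card A = sum c (\<Union>(N ` A))" by blast
      have "finite A" using A(2) less.prems(1) finite_subset by blast
      have "\<exists>f. (\<forall>x\<in>A. f x \<in> N x) \<and> (\<forall>y. card {x \<in> A. f x = y} \<le> c y)"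
        using A(2) less.prems by (intro less.hyps) (auto intro: psubset_card_mono finite_subset)
      then obtain f where f: "\<forall>x\<in>A. f x \<in> N x" "\<forall>y. card {x \<in> A. f x = y} \<le> c y" by blast
      \<comment> \<open>\<open>A\<close> may use up the entire capacity of its neighborhood, so the
        rest gets none of it. Tightness cancels the share of \<open>A\<close> in the condition for
        \<open>A \<union> A'\<close>.\<close>
      define c' where "c' y = (if y \<in> \<Union>(N ` A) then 0 else c y)" for y
      have "\<exists>g. (\<forall>x\<in>X - A. g x \<in> N x) \<and> (\<forall>y. card {x \<in> X - A. g x = y} \<le> c' y)"
      proof (rule less.hyps)
        show "card (X - A) < card X"
          using A less.prems(1) by (intro psubset_card_mono) auto
        fix A' assume A': "A' \<subseteq> X - A"
        have "finite A'" using A' less.prems(1) finite_subset by blast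
        have "card A + card A' = card (A \<union> A')"
          using A' \<open>finite A\<close> \<open>finite A'\<close> by (intro card_Un_disjoint[symmetric]) auto
        also have "\<dots> \<le> sum c (\<Union>(N ` (A \<union> A')))"
          using A(2) A' by (intro less.prems(3)) auto
        also have "\<Union>(N ` (A \<union> A')) = \<Union>(N ` A) \<union> (\<Union>(N ` A') - \<Union>(N ` A))" by auto
        also have "sum c \<dots> = sum c (\<Union>(N ` A)) + sum c (\<Union>(N ` A') - \<Union>(N ` A))"
          using fin[of A] fin[of A'] A(2) A' by (intro sum.union_disjoint) auto
        also have "sum c (\<Union>(N ` A') - \<Union>(N ` A)) = sum c' (\<Union>(N ` A'))"
          using fin[of A'] A' by (intro sum.mono_neutral_cong_left) (auto simp: c'_def)
        finally show "card A' \<le> sum c' (\<Union>(N ` A'))" using A(3) by simp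
      qed (use less.prems in auto)
      then obtain g where g: "\<forall>x\<in>X - A. g x \<in> N x" "\<forall>y. card {x \<in> X - A. g x = y} \<le> c' y"
        by blast
      define h where "h x = (if x \<in> A then f x else g x)" for x
      have "card {x \<in> X. h x = y} \<le> c y" for y
      proof (cases "y \<in> \<Union>(N ` A)")
        case True
        then have "{x \<in> X - A. g x = y} = {}"
          using g(2)[rule_format, of y] less.prems(1) by (simp add: c'_def)
        then have "{x \<in> X. h x = y} = {x \<in> A. f x = y}" using A(2) by (auto simp: h_def)
        then show ?thesis using f(2) by simp
      next
        case False
        then have "{x \<in> X. h x = y} = {x \<in> X - A. g x = y}" using f(1) by (auto simp: h_def)
        then show ?thesis using g(2)[rule_format, of y] False by (simp add: c'_def)
      qed
      then show ?thesis using f(1) g(1) by (intro exI[of _ h]) (auto simp: h_def)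
    next
      case not_tight: False
      obtain x where x: "x \<in> X" using False by blast
      have "1 \<le> sum c (N x)" using less.prems(3)[of "{x}"] x by simp
      then obtain y where y: "y \<in> N x" "0 < c y"
        by (metis not_one_le_zero sum.neutral neq0_conv)
      \<comment> \<open>One unit at \<open>y\<close> is spent on \<open>x\<close>, and the slack of
        every remaining nonempty subset makes up for it.\<close>
      define c' where "c' = c(y := c y - 1)"
      have "\<exists>f. (\<forall>z\<in>X - {x}. f z \<in> N z) \<and> (\<forall>w. card {z \<in> X - {x}. f z = w} \<le> c' w)"
      proof (rule less.hyps)
        show "card (X - {x}) < card X" using x less.prems(1) by (intro psubset_card_mono) auto
        fix A assume A: "A \<subseteq> X - {x}"
        show "card A \<le> sum c' (\<Union>(N ` A))"
        proof (cases "A = {}")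
          case False
          have "A \<subset> X" using A x by blast
          then have "card A < sum c (\<Union>(N ` A))"
            using not_tight False less.prems(3)[of A] by (meson le_neq_trans less_imp_le psubset_imp_subset)
          moreover have "sum c (\<Union>(N ` A)) \<le> sum c' (\<Union>(N ` A)) + 1"
          proof -
            have "sum c (\<Union>(N ` A)) \<le> sum (\<lambda>z. c' z + (if z = y then 1 else 0)) (\<Union>(N ` A))"
              by (rule sum_mono) (auto simp: c'_def)
            also have "\<dots> \<le> sum c' (\<Union>(N ` A)) + 1"
              using fin[of A] \<open>A \<subset> X\<close> by (simp add: sum.distrib)
            finally show ?thesis .
          qed
          ultimately show ?thesis by linarith
        qed simp
      qed (use less.prems in auto)
      then obtain f where f: "\<forall>z\<in>X - {x}. f z \<in> N z" "\<forall>w. card {z \<in> X - {x}. f z = w} \<le> c' w"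
        by blast
      define h where "h = f(x := y)"
      have "card {z \<in> X. h z = w} \<le> c w" for w
      proof (cases "w = y")
        case True
        have "{z \<in> X. h z = y} = insert x {z \<in> X - {x}. f z = y}" using x by (auto simp: h_def)
        then have "card {z \<in> X. h z = y} = Suc (card {z \<in> X - {x}. f z = y})"
          using less.prems(1) by simp
        also have "\<dots> \<le> Suc (c' y)" using f(2) by simp
        also have "\<dots> = c y" using y(2) by (simp add: c'_def)
        finally show ?thesis using True by simp
      next
        case False
        then have "{z \<in> X. h z = w} = {z \<in> X - {x}. f z = w}" by (auto simp: h_def)
        then show ?thesis using f(2)[rule_format, of w] False by (simp add: c'_def)
      qed
      then show ?thesis using f(1) y(1) by (intro exI[of _ h]) (auto simp: h_def)
    qed
  qed simp
qed


section \<open>Backup centers absorb every failure\<close>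

primrec hops :: "'a pair_pre_digraph \<Rightarrow> 'a set \<Rightarrow> 'a set \<Rightarrow> nat \<Rightarrow> 'a set" where
  "hops G F A 0 = A"
| "hops G F A (Suc i) = hops G F A i \<union> (F \<inter> nbhd G 6 (hops G F A i))"

text \<open>The start has at least one element and every round before stabilization adds another one
  of \<open>F\<close>, so stabilization occurs strictly before \<open>card F\<close>. Strictness
  leaves room for a last hop from a failed center to a surviving backup.\<close>

lemma hops_stable:
  assumes "finite F" "A \<subseteq> F" "A \<noteq> {}"
  obtains i where "i < card F" "hops G F A (Suc i) = hops G F A i"
proof -
  have sub: "hops G F A i \<subseteq> F" for i using assms(2) by (induction i) auto
  have "(\<exists>i<m. hops G F A (Suc i) = hops G F A i) \<or> m < card (hops G F A m)" for m
  proof (induction m)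
    case 0
    then show ?case using assms finite_subset by (simp add: card_gt_0_iff) blast
  next
    case (Suc m)
    show ?case
    proof (cases "hops G F A (Suc m) = hops G F A m")
      case False
      then have "hops G F A m \<subset> hops G F A (Suc m)" by auto
      then have "card (hops G F A m) < card (hops G F A (Suc m))"
        using sub assms(1) finite_subset by (intro psubset_card_mono) blast+
      then show ?thesis using Suc by (auto simp del: hops.simps intro: less_SucI)
    qed blast
  qed
  from this[of "card F"] card_mono[OF assms(1) sub, of "card F"] show thesis
    using that by (auto simp del: hops.simps)
qed

lemma hops_gdist:
  assumes G: "pair_graph G" and A: "A \<subseteq> pverts G" and v: "v \<in> hops G F A i"
  shows "\<exists>a\<in>A. gdist G a v \<le> ereal (6 * real i)"
  using v
proof (induction i arbitrary: v)
  case 0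
  then show ?case using gdist_refl[OF G, of v 0] A by auto
next
  case (Suc i)
  then consider "v \<in> hops G F A i" | w where "w \<in> hops G F A i" "gdist G v w \<le> ereal 6"
    by (auto simp: nbhd_def)
  then show ?case
  proof cases
    case 1
    then obtain a where "a \<in> A" "gdist G a v \<le> ereal (6 * real i)" using Suc.IH by blast
    then show ?thesis by (auto intro!: bexI[of _ a] elim: order_trans)
  next
    case 2
    then obtain a where "a \<in> A" "gdist G a w \<le> ereal (6 * real i)" using Suc.IH by blast
    moreover from gdist_triangle[OF G this(2) gdist_sym[OF G 2(2)]]
    have "gdist G a v \<le> ereal (6 * real (Suc i))" by (simp add: algebra_simps)
    ultimately show ?thesis by blast
  qed
qed

text \<open>Failed backup centers in reach are replaced in turn, which lengthens the chain by a hop at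
  most once per failed center.\<close>

lemma backup_capacity:
  fixes L :: "'a \<Rightarrow> nat"
  assumes G: "pair_graph G" and F: "F \<subseteq> pverts G" "finite F" "A \<subseteq> F"
    and B: "finite B" and viol: "\<And>U. U \<subseteq> F \<Longrightarrow> sum L U \<le> sum L (B \<inter> nbhd G 6 U)"
    and disj: "A \<inter> B = {}"
  shows "sum L A \<le> sum L {b \<in> B - F. \<exists>a\<in>A. gdist G a b \<le> ereal (6 * real (card F))}"
proof (cases "A = {}")
  case False
  obtain i where i: "i < card F" "hops G F A (Suc i) = hops G F A i"
    by (rule hops_stable[OF F(2,3) False, where G = G])
  define U where "U = hops G F A i"
  have "hops G F A j \<subseteq> F" "A \<subseteq> hops G F A j" for j using F(3) by (induction j) auto
  then have U: "U \<subseteq> F" "A \<subseteq> U" by (auto simp: U_def)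
  have closed: "F \<inter> nbhd G 6 U \<subseteq> U" using i(2) by (auto simp: U_def)
  let ?M = "B \<inter> nbhd G 6 U"
  have "U \<inter> B \<subseteq> ?M"
    using U F(1) gdist_refl[OF G, of _ 6] by (force simp: nbhd_def)
  then have "?M \<inter> F = U \<inter> B" using closed U by blast
  have fU: "finite U" using U F(2) finite_subset by blast
  \<comment> \<open>\<open>A\<close> avoids \<open>B\<close>, so \<open>sum L U\<close> covers both
    \<open>A\<close> and the failed backups in \<open>U\<close>. As \<open>U\<close> is closed under
    hops, the latter are exactly the failed members of \<open>?M\<close> and cancel on the two
    sides.\<close>
  have "sum L A + sum L (U \<inter> B) \<le> sum L U"
    using U disj fU finite_subset[OF U(2) fU]
    by (subst sum.union_disjoint[symmetric]) (auto intro!: sum_mono2)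
  also have "\<dots> \<le> sum L ?M" using viol U by blast
  also have "\<dots> = sum L (?M - F) + sum L (U \<inter> B)"
    using B \<open>?M \<inter> F = U \<inter> B\<close> sum.Int_Diff[of ?M L F] by simp
  finally have "sum L A \<le> sum L (?M - F)" by simp
  also have "\<dots> \<le> sum L {b \<in> B - F. \<exists>a\<in>A. gdist G a b \<le> ereal (6 * real (card F))}"
  proof (rule sum_mono2)
    show "?M - F \<subseteq> {b \<in> B - F. \<exists>a\<in>A. gdist G a b \<le> ereal (6 * real (card F))}"
    proof
      fix b assume "b \<in> ?M - F"
      then obtain u where b: "b \<in> B - F" "u \<in> U" "gdist G b u \<le> ereal 6" by (auto simp: nbhd_def)
      obtain a where a: "a \<in> A" "gdist G a u \<le> ereal (6 * real i)"
        using hops_gdist[OF G _ b(2)[unfolded U_def]] F by blast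
      have "gdist G a b \<le> ereal (6 * real i + 6)"
        by (rule gdist_triangle[OF G a(2) gdist_sym[OF G b(3)]])
      also have "\<dots> \<le> ereal (6 * real (card F))" using i(1) by simp
      finally show "b \<in> {b \<in> B - F. \<exists>a\<in>A. gdist G a b \<le> ereal (6 * real (card F))}"
        using a b by blast
    qed
  qed (use B in auto)
  finally show ?thesis .
qed simp

text \<open>Under \<open>\<phi>\<close> the backups serve nobody, having capacity zero, and so can
  offer their full capacity \<open>L\<close> after a failure. Only the clients of failed centers are
  moved, which makes the answer conservative.\<close>

lemma ft_solution_backup:
  assumes G: "pair_graph G" and B: "B \<subseteq> pverts G"
    and viol: "\<And>U. \<not> violating \<alpha> ((G, k, L), B) U"
    and S: "S \<subseteq> pverts G" and \<phi>: "assignment G (\<lambda>u. if u \<in> B then 0 else L u) r S \<phi>"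
    and k: "card (S \<union> B) \<le> k"
  shows "ft_solution \<alpha> (r + 6 * real \<alpha>) (G, k, L) (S \<union> B, \<phi>)"
proof -
  interpret pair_graph G by fact
  have finV: "finite (pverts G)" by (rule pair_finite_verts)
  let ?r = "r + 6 * real \<alpha>"
  have r: "ereal r \<le> ereal ?r" by simp
  have \<phi>_in: "\<phi> u \<in> S" "\<phi> u \<in> pverts G" "gdist G u (\<phi> u) \<le> ereal r" if "u \<in> pverts G" for u
    using \<phi> S that by (auto simp: assignment_def)
  have \<phi>_card: "card {u \<in> pverts G. \<phi> u = v} \<le> (if v \<in> B then 0 else L v)" if "v \<in> pverts G" for v
    using \<phi> that by (auto simp: assignment_def)
  have \<phi>_B: "\<phi> u \<notin> B" if "u \<in> pverts G" for u
  proof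
    assume "\<phi> u \<in> B"
    then have "{u' \<in> pverts G. \<phi> u' = \<phi> u} = {}"
      using \<phi>_card[OF \<phi>_in(2)[OF that]] finV by simp
    with that show False by blast
  qed
  have \<phi>_card': "card {u \<in> pverts G. \<phi> u = v} \<le> L v" if "v \<in> pverts G" for v
    using \<phi>_card[OF that] by (rule order_trans) simp
  have "assignment G L ?r (S \<union> B) \<phi>"
    using \<phi>_in \<phi>_card' r unfolding assignment_def by (auto intro: order_trans[OF _ r])
  moreover have "\<exists>\<phi>F. assignment G L ?r (S \<union> B - F) \<phi>F \<and>
      (\<forall>u\<in>pverts G. \<phi> u \<notin> F \<longrightarrow> \<phi>F u = \<phi> u)" if F: "F \<subseteq> S \<union> B" "card F \<le> \<alpha>" for F
  proof -
    have FV: "F \<subseteq> pverts G" using F S B by blast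
    have finF: "finite F" and finB: "finite B" using FV B finV finite_subset by blast+
    define X where "X = {u \<in> pverts G. \<phi> u \<in> F}"
    define N where "N u = {b \<in> B - F. gdist G (\<phi> u) b \<le> ereal (6 * real (card F))}" for u
    \<comment> \<open>Admissibility is measured from the old center \<open>\<phi> u\<close> and not
      from the client, which turns Hall's condition into an inequality between capacities of
      centers.\<close>
    have "\<exists>g. (\<forall>u\<in>X. g u \<in> N u) \<and> (\<forall>b. card {u \<in> X. g u = b} \<le> L b)"
    proof (rule hall_capacities)
      show "finite X" using finV by (simp add: X_def)
      show "finite (N u)" for u using finB by (simp add: N_def)
      fix A assume A: "A \<subseteq> X"
      have finA: "finite A" using A finV by (auto simp: X_def intro: finite_subset)
      have "card A \<le> card {u \<in> pverts G. \<phi> u \<in> \<phi> ` A}"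
        using A finV by (intro card_mono) (auto simp: X_def)
      also have "{u \<in> pverts G. \<phi> u \<in> \<phi> ` A} = (\<Union>v\<in>\<phi> ` A. {u \<in> pverts G. \<phi> u = v})" by auto
      also have "card \<dots> \<le> (\<Sum>v\<in>\<phi> ` A. card {u \<in> pverts G. \<phi> u = v})"
        using finA by (intro card_UN_le) simp
      also have "\<dots> \<le> sum L (\<phi> ` A)"
        using A \<phi>_in(2) by (intro sum_mono \<phi>_card') (auto simp: X_def)
      also have "\<dots> \<le> sum L {b \<in> B - F. \<exists>a\<in>\<phi> ` A. gdist G a b \<le> ereal (6 * real (card F))}"
      proof (rule backup_capacity[OF G FV finF _ finB])
        show "\<phi> ` A \<subseteq> F" "\<phi> ` A \<inter> B = {}" using A \<phi>_B by (auto simp: X_def)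
        fix U assume U: "U \<subseteq> F"
        \<comment> \<open>The stopping criterion speaks about every subset of \<open>F\<close>, as
          \<open>F\<close> has at most \<alpha> elements.\<close>
        then have "card U \<le> \<alpha>" using F(2) finF card_mono order_trans by blast
        with viol[of U] U FV show "sum L U \<le> sum L (B \<inter> nbhd G 6 U)" by auto
      qed
      also have "{b \<in> B - F. \<exists>a\<in>\<phi> ` A. gdist G a b \<le> ereal (6 * real (card F))} = \<Union>(N ` A)"
        by (auto simp: N_def)
      finally show "card A \<le> sum L (\<Union>(N ` A))" .
    qed
    then obtain g where g: "\<forall>u\<in>X. g u \<in> N u" "\<forall>b. card {u \<in> X. g u = b} \<le> L b" by blast
    define \<psi> where "\<psi> u = (if \<phi> u \<in> F then g u else \<phi> u)" for u
    have "\<psi> u \<in> S \<union> B - F \<and> gdist G u (\<psi> u) \<le> ereal ?r" if u: "u \<in> pverts G" for u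
    proof (cases "\<phi> u \<in> F")
      case True
      then have gu: "g u \<in> B - F" "gdist G (\<phi> u) (g u) \<le> ereal (6 * real (card F))"
        using g(1) u by (auto simp: X_def N_def)
      have "gdist G u (g u) \<le> ereal (r + 6 * real (card F))"
        by (rule gdist_triangle[OF G \<phi>_in(3)[OF u] gu(2)])
      also have "\<dots> \<le> ereal ?r" using F(2) by simp
      finally show ?thesis using gu True by (simp add: \<psi>_def)
    next
      case False
      then show ?thesis using \<phi>_in[OF u] by (auto simp: \<psi>_def intro: order_trans[OF _ r])
    qed
    moreover have "card {u \<in> pverts G. \<psi> u = v} \<le> L v" if v: "v \<in> pverts G" for v
    proof (cases "v \<in> B")
      case True
      have in_F: "\<phi> u \<in> F" if "u \<in> pverts G" "\<psi> u = v" for u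
        using \<phi>_B[OF that(1)] that(2) True by (auto simp: \<psi>_def split: if_splits)
      have "{u \<in> pverts G. \<psi> u = v} \<subseteq> {u \<in> X. g u = v}"
      proof
        fix u assume "u \<in> {u \<in> pverts G. \<psi> u = v}"
        with in_F[of u] show "u \<in> {u \<in> X. g u = v}" by (simp add: \<psi>_def X_def)
      qed
      then have "card {u \<in> pverts G. \<psi> u = v} \<le> card {u \<in> X. g u = v}"
        using finV by (intro card_mono) (auto simp: X_def)
      then show ?thesis using g(2) order_trans by blast
    next
      case False
      then have "{u \<in> pverts G. \<psi> u = v} \<subseteq> {u \<in> pverts G. \<phi> u = v}"
        using g(1) by (auto simp: \<psi>_def X_def N_def)
      then have "card {u \<in> pverts G. \<psi> u = v} \<le> card {u \<in> pverts G. \<phi> u = v}"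
        using finV by (intro card_mono) auto
      then show ?thesis using \<phi>_card'[OF v] by linarith
    qed
    ultimately have "assignment G L ?r (S \<union> B - F) \<psi>" by (auto simp: assignment_def)
    then show ?thesis by (intro exI[of _ \<psi>]) (auto simp: \<psi>_def)
  qed
  ultimately show ?thesis using S B k by simp
qed


section \<open>Backup centers are affordable\<close>

text \<open>In the loop, \<open>P\<close> consists of the sets added so far, less what was removed
  from them later. Distinct parts inside the vertex set are disjoint because a common vertex would
  be at distance 0 from itself.\<close>

definition separated :: "'a pair_pre_digraph \<Rightarrow> nat \<Rightarrow> 'a set \<Rightarrow> bool" where
  "separated G \<alpha> B \<longleftrightarrow> (\<exists>P. \<Union>P = B \<and> (\<forall>W\<in>P. card W \<le> \<alpha>) \<and>
     (\<forall>W\<in>P. \<forall>W'\<in>P. W \<noteq> W' \<longrightarrow> (\<forall>w\<in>W. \<forall>w'\<in>W'. \<not> gdist G w w' \<le> ereal 6)))"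

lemma separated_empty: "separated G \<alpha> {}"
  unfolding separated_def by (rule exI[of _ "{}"]) simp

text \<open>What lies near \<open>U\<close> is deleted from the old parts, so \<open>U\<close> can
  be a part of its own. The old parts only shrink, which preserves both conditions on them.\<close>

lemma separated_replace:
  assumes G: "pair_graph G" and B: "separated G \<alpha> B" "B \<subseteq> pverts G" and U: "card U \<le> \<alpha>"
  shows "separated G \<alpha> (B - nbhd G 6 U \<union> U)"
proof -
  interpret pair_graph G by fact
  obtain P where P: "\<Union>P = B" "\<And>W. W \<in> P \<Longrightarrow> card W \<le> \<alpha>"
    "\<And>W W' w w'. W \<in> P \<Longrightarrow> W' \<in> P \<Longrightarrow> W \<noteq> W' \<Longrightarrow> w \<in> W \<Longrightarrow> w' \<in> W' \<Longrightarrow> \<not> gdist G w w' \<le> ereal 6"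
    using B(1) unfolding separated_def by metis
  define Q where "Q = (\<lambda>W. W - nbhd G 6 U) ` P"
  have far: "\<not> gdist G w u \<le> ereal 6" "\<not> gdist G u w \<le> ereal 6" if "W \<in> Q" "w \<in> W" "u \<in> U" for W w u
  proof -
    have "w \<in> pverts G" "w \<notin> nbhd G 6 U" using that P(1) B(2) by (auto simp: Q_def)
    then show "\<not> gdist G w u \<le> ereal 6" using that(3) by (auto simp: nbhd_def)
    then show "\<not> gdist G u w \<le> ereal 6" using gdist_sym[OF G] by blast
  qed
  have "card W \<le> \<alpha>" if "W \<in> insert U Q" for W
  proof (cases "W = U")
    case False
    then obtain W' where W': "W' \<in> P" "W = W' - nbhd G 6 U" using \<open>W \<in> _\<close> by (auto simp: Q_def)
    have "finite W'" using W' P(1) B(2) pair_finite_verts by (meson Union_upper finite_subset)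
    then have "card W \<le> card W'" using W' by (intro card_mono) auto
    with P(2)[OF W'(1)] show ?thesis by linarith
  qed (use U in simp)
  moreover have "\<not> gdist G w w' \<le> ereal 6"
    if "W \<in> insert U Q" "W' \<in> insert U Q" "W \<noteq> W'" "w \<in> W" "w' \<in> W'" for W W' w w'
  proof -
    consider "W = U" "W' \<in> Q" | "W \<in> Q" "W' = U" | "W \<in> Q" "W' \<in> Q" 
      using \<open>W \<in> insert U Q\<close> \<open>W' \<in> insert U Q\<close> \<open>W \<noteq> W'\<close> by blast
    then show ?thesis
    proof cases
      case 3
      then obtain V V' where "V \<in> P" "V' \<in> P" "W = V - nbhd G 6 U" "W' = V' - nbhd G 6 U"
        by (auto simp: Q_def)
      then show ?thesis using P(3)[of V V' w w'] that by blast
    qed (use far that in blast)+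
  qed
  moreover have "\<Union>(insert U Q) = B - nbhd G 6 U \<union> U" using P(1) by (auto simp: Q_def)
  ultimately show ?thesis unfolding separated_def by (intro exI[of _ "insert U Q"]) blast
qed

text \<open>Around each part \<open>W\<close> of \<open>B\<close>, an optimal solution has at least \<open>|W|\<close> centers within distance
  \<open>1\<close>, since otherwise all of them may fail. Let \<open>|W|\<close> of them fail, including those in \<open>W\<close>.
  The clients concerned are then reassigned within distance \<open>3\<close> of \<open>W\<close>, so that these changes
  do not interfere for different parts.\<close>

lemma cap_solution_reduced:
  assumes G: "pair_graph G" and B: "B \<subseteq> pverts G" "separated G \<alpha> B"
    and sol: "ft_solution \<alpha> 1 (G, k, L) (S, \<phi>)"
  shows "\<exists>s. cap_solution 1 (reduced ((G, k, L), B)) s"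
proof -
  interpret pair_graph G by fact
  have finV: "finite (pverts G)" by (rule pair_finite_verts)
  obtain P where P: "\<Union>P = B" "\<And>W. W \<in> P \<Longrightarrow> card W \<le> \<alpha>"
    "\<And>W W' w w'. W \<in> P \<Longrightarrow> W' \<in> P \<Longrightarrow> W \<noteq> W' \<Longrightarrow> w \<in> W \<Longrightarrow> w' \<in> W' \<Longrightarrow> \<not> gdist G w w' \<le> ereal 6"
    using B(2) unfolding separated_def by metis
  have S: "S \<subseteq> pverts G" "card S \<le> k" and \<phi>: "assignment G L 1 S \<phi>"
    and ft: "\<And>F. F \<subseteq> S \<Longrightarrow> card F \<le> \<alpha> \<Longrightarrow> \<exists>\<psi>. assignment G L 1 (S - F) \<psi> \<and>
        (\<forall>u \<in> pverts G. \<phi> u \<notin> F \<longrightarrow> \<psi> u = \<phi> u)"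
    using sol by auto
  have finS: "finite S" and finB: "finite B" using S(1) B(1) finV finite_subset by blast+
  have WV: "W \<subseteq> pverts G" "finite W" if "W \<in> P" for W
    using that P(1) B(1) finB by (auto intro: finite_subset)
  \<comment> \<open>\<open>x\<close> pairs a failure set for \<open>W\<close> with an assignment
    answering it, so that both are chosen at once.\<close>
  define Q where "Q W x \<longleftrightarrow> W \<inter> S \<subseteq> fst x \<and> fst x \<subseteq> S \<inter> nbhd G 1 W \<and> card (fst x) = card W \<and>
      assignment G L 1 (S - fst x) (snd x) \<and> (\<forall>u \<in> pverts G. \<phi> u \<notin> fst x \<longrightarrow> snd x u = \<phi> u)" for W x
  have "\<exists>x. Q W x" if W: "W \<in> P" for W
  proof -
    have "card W \<le> card (S \<inter> nbhd G 1 W)"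
    proof (rule ccontr)
      assume less: "\<not> card W \<le> card (S \<inter> nbhd G 1 W)"
      then have "card (S \<inter> nbhd G 1 W) \<le> \<alpha>" using P(2)[OF W] by linarith
      then obtain \<psi> where \<psi>: "assignment G L 1 (S - S \<inter> nbhd G 1 W) \<psi>" using ft by blast
      obtain w where w: "w \<in> W" using less by fastforce
      have "w \<in> pverts G" using w WV[OF W] by blast
      then have "\<psi> w \<in> S - nbhd G 1 W" "gdist G w (\<psi> w) \<le> ereal 1"
        using \<psi> by (auto simp: assignment_def)
      with w S(1) gdist_sym[OF G, of w "\<psi> w" 1] show False by (auto simp: nbhd_def)
    qed
    moreover have "W \<inter> S \<subseteq> S \<inter> nbhd G 1 W"
      using WV[OF W] gdist_refl[OF G, of _ 1] by (force simp: nbhd_def)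
    moreover have "card (W \<inter> S) \<le> card W" using WV[OF W] by (intro card_mono) auto
    \<comment> \<open>Letting all of \<open>W \<inter> S\<close> fail keeps \<open>B\<close> out of
      the remaining centers, as \<open>B\<close> has capacity zero in the reduced instance.\<close>
    ultimately obtain F where F: "W \<inter> S \<subseteq> F" "F \<subseteq> S \<inter> nbhd G 1 W" "card F = card W"
      using exists_subset_between[of "W \<inter> S" "card W" "S \<inter> nbhd G 1 W"] finS by auto
    moreover obtain \<psi> where "assignment G L 1 (S - F) \<psi>" "\<forall>u\<in>pverts G. \<phi> u \<notin> F \<longrightarrow> \<psi> u = \<phi> u"
      using ft[of F] F P(2)[OF W] by auto
    ultimately show ?thesis unfolding Q_def by (intro exI[of _ "(F, \<psi>)"]) simp
  qed
  then have "\<forall>W\<in>P. \<exists>x. Q W x" by blast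
  from bchoice[OF this] obtain h where h: "\<forall>W\<in>P. Q W (h W)" by blast
  define F \<psi> where "F W = fst (h W)" and "\<psi> W = snd (h W)" for W
  have F: "\<And>W. W \<in> P \<Longrightarrow> W \<inter> S \<subseteq> F W" "\<And>W. W \<in> P \<Longrightarrow> F W \<subseteq> S \<inter> nbhd G 1 W"
      "\<And>W. W \<in> P \<Longrightarrow> card (F W) = card W"
    and \<psi>: "\<And>W. W \<in> P \<Longrightarrow> assignment G L 1 (S - F W) (\<psi> W)"
      "\<And>W u. W \<in> P \<Longrightarrow> u \<in> pverts G \<Longrightarrow> \<phi> u \<notin> F W \<Longrightarrow> \<psi> W u = \<phi> u"
    using h unfolding Q_def F_def \<psi>_def by blast+
  \<comment> \<open>Here the radius of the neighborhoods is used: two parts within distance 3 of a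
    common vertex would be within 6 of each other.\<close>
  have same: "W = W'" if "W \<in> P" "W' \<in> P" "w \<in> W" "w' \<in> W'"
    "gdist G w v \<le> ereal 3" "gdist G w' v \<le> ereal 3" for W W' w w' v
    using gdist_triangle[OF G that(5) gdist_sym[OF G that(6)]] P(3)[OF that(1,2) _ that(3,4)] by auto
  have near: "\<exists>w\<in>W. gdist G w v \<le> ereal 1" if "W \<in> P" "v \<in> F W" for W v
    using F(2)[OF that(1)] that(2) gdist_sym[OF G] by (fastforce simp: nbhd_def)
  have \<phi>_in: "\<phi> u \<in> S" "gdist G u (\<phi> u) \<le> ereal 1" if "u \<in> pverts G" for u
    using \<phi> that by (auto simp: assignment_def)
  have \<psi>_in: "\<psi> W u \<in> S - F W" "gdist G u (\<psi> W u) \<le> ereal 1" if "W \<in> P" "u \<in> pverts G" for W u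
    using \<psi>(1) that by (auto simp: assignment_def)
  \<comment> \<open>From \<open>w\<close> to the failed center, on to its client, and on to the new
    center: three steps of length at most 1.\<close>
  have near3: "\<exists>w\<in>W. gdist G w (\<psi> W u) \<le> ereal 3" if "W \<in> P" "u \<in> pverts G" "\<phi> u \<in> F W" for W u
  proof -
    obtain w where w: "w \<in> W" "gdist G w (\<phi> u) \<le> ereal 1" using near[OF \<open>W \<in> P\<close> \<open>\<phi> u \<in> F W\<close>] by blast
    have "gdist G w (\<psi> W u) \<le> ereal (1 + 1 + 1)"
      by (rule gdist_triangle[OF G gdist_triangle[OF G w(2) gdist_sym[OF G \<phi>_in(2)[OF that(2)]]]
            \<psi>_in(2)[OF that(1,2)]])
    with w(1) show ?thesis by auto
  qed
  have near_F: "\<exists>w\<in>W. gdist G w v \<le> ereal 3" if "W \<in> P" "v \<in> F W" for W v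
    using near[OF that] by (auto intro!: bexI elim: order_trans)
  have disj: "F W \<inter> F W' = {}" if "W \<in> P" "W' \<in> P" "W \<noteq> W'" for W W'
    using near_F[OF that(1)] near_F[OF that(2)] same[OF that(1,2)] that(3) by blast
  define R where "R = S - (\<Union>W\<in>P. F W)"
  \<comment> \<open>The failure sets of different parts are disjoint, so the choice made by
    \<open>SOME\<close> is forced.\<close>
  define \<theta> where "\<theta> u = (if \<exists>W\<in>P. \<phi> u \<in> F W then \<psi> (SOME W. W \<in> P \<and> \<phi> u \<in> F W) u else \<phi> u)" for u
  have \<theta>1: "\<theta> u = \<psi> W u" if "W \<in> P" "\<phi> u \<in> F W" for u W
  proof -
    have "(SOME W. W \<in> P \<and> \<phi> u \<in> F W) = W"
      using that disj by (intro some_equality) blast+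
    then show ?thesis using that by (auto simp: \<theta>_def)
  qed
  have \<theta>2: "\<theta> u = \<phi> u" if "\<And>W. W \<in> P \<Longrightarrow> \<phi> u \<notin> F W" for u
    using that by (auto simp: \<theta>_def)
  have "R \<subseteq> pverts G" using S(1) by (auto simp: R_def)
  moreover have "card R \<le> k - card B"
  proof -
    have finP: "finite P" using finB P(1) by (simp add: finite_UnionD)
    have finF: "finite (F W)" if "W \<in> P" for W using F(2)[OF that] finS finite_subset by blast
    have "card (\<Union>W\<in>P. F W) = (\<Sum>W\<in>P. card (F W))"
      by (rule card_UN_disjoint) (use finP finF disj in auto)
    also have "\<dots> = (\<Sum>W\<in>P. card W)" by (intro sum.cong refl F(3))
    also have "\<dots> = card B"
    proof -
      have disj': "W \<inter> W' = {}" if "W \<in> P" "W' \<in> P" "W \<noteq> W'" for W W'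
      proof (rule equals0I)
        fix w assume "w \<in> W \<inter> W'"
        then show False
          using P(3)[OF that, of w w] WV(1)[OF that(1)] gdist_refl[OF G, of w 6] by auto
      qed
      have "card (\<Union>P) = (\<Sum>W\<in>P. card W)"
        using disj' WV(2) by (intro card_Union_disjoint) (auto simp: pairwise_def disjnt_def)
      then show ?thesis using P(1) by simp
    qed
    finally have "card R = card S - card B"
      unfolding R_def using F(2) finP finF by (subst card_Diff_subset) (simp, blast, simp)
    then show ?thesis using S(2) by simp
  qed
  moreover have "assignment G (\<lambda>u. if u \<in> B then 0 else L u) 1 R \<theta>"
  proof -
    have \<theta>_in: "\<theta> u \<in> R \<and> gdist G u (\<theta> u) \<le> ereal 1" if u: "u \<in> pverts G" for u
    proof (cases "\<exists>W\<in>P. \<phi> u \<in> F W")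
      case True
      then obtain W where W: "W \<in> P" "\<phi> u \<in> F W" by blast
      \<comment> \<open>The new center avoids \<open>F W\<close> by the choice of
        \<open>\<psi> W\<close>, and it is too close to \<open>W\<close> to belong to the failure
        set of another part.\<close>
      have "\<psi> W u \<notin> F W'" if "W' \<in> P" for W'
      proof
        assume "\<psi> W u \<in> F W'"
        then have "W = W'"
          using near3[OF W(1) u W(2)] near_F[OF that] same[OF W(1) that] by blast
        with \<psi>_in[OF W(1) u] \<open>\<psi> W u \<in> F W'\<close> show False by blast
      qed
      then show ?thesis using \<theta>1[OF W] \<psi>_in[OF W(1) u] by (auto simp: R_def)
    next
      case False
      then show ?thesis using \<theta>2[of u] \<phi>_in[OF u] by (auto simp: R_def)
    qed
    moreover have "card {u \<in> pverts G. \<theta> u = v} \<le> (if v \<in> B then 0 else L v)" if v: "v \<in> pverts G" for v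
    proof (cases "v \<in> R")
      case False
      then have "{u \<in> pverts G. \<theta> u = v} = {}" using \<theta>_in by auto
      then show ?thesis by (metis card.empty le0)
    next
      case True
      then have "v \<notin> B" using F(1) P(1) by (auto simp: R_def)
      have vF: "v \<notin> F W" if "W \<in> P" for W using True that by (auto simp: R_def)
      show ?thesis
      proof (cases "\<exists>u\<in>pverts G. \<theta> u = v \<and> (\<exists>W\<in>P. \<phi> u \<in> F W)")
        case True
        then obtain u W where u: "u \<in> pverts G" "\<theta> u = v" "W \<in> P" "\<phi> u \<in> F W" by blast
        \<comment> \<open>Once some moved client of \<open>W\<close> reaches \<open>v\<close>, all
          clients of \<open>v\<close> under \<open>\<theta>\<close> are its clients under the single
          assignment \<open>\<psi> W\<close>, whose capacity bound then applies: moved ones stem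
          from the same \<open>W\<close>, and the others keep their center under
          \<open>\<psi> W\<close> by conservativity.\<close>
        have "\<psi> W u' = v" if u': "u' \<in> pverts G" "\<theta> u' = v" for u'
        proof (cases "\<exists>W'\<in>P. \<phi> u' \<in> F W'")
          case True
          then obtain W' where W': "W' \<in> P" "\<phi> u' \<in> F W'" by blast
          have "W = W'"
            using near3[OF u(3,1,4)] near3[OF W'(1) u'(1) W'(2)] same[OF u(3) W'(1)]
              \<theta>1[OF u(3,4)] \<theta>1[OF W'] u(2) u'(2) by auto
          then show ?thesis using \<theta>1[OF W'] u'(2) by simp
        next
          case False
          then have "\<phi> u' = v" using \<theta>2[of u'] u'(2) by auto
          then show ?thesis using \<psi>(2)[OF u(3) u'(1)] vF[OF u(3)] by simp
        qed
        then have "card {u \<in> pverts G. \<theta> u = v} \<le> card {u \<in> pverts G. \<psi> W u = v}"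
          using finV by (intro card_mono) auto
        also have "\<dots> \<le> L v" using \<psi>(1)[OF u(3)] v by (auto simp: assignment_def)
        finally show ?thesis using \<open>v \<notin> B\<close> by simp
      next
        case False
        have "\<phi> u = v" if "u \<in> pverts G" "\<theta> u = v" for u using False \<theta>2[of u] that by auto
        then have "card {u \<in> pverts G. \<theta> u = v} \<le> card {u \<in> pverts G. \<phi> u = v}"
          using finV by (intro card_mono) auto
        also have "\<dots> \<le> L v" using \<phi> v by (auto simp: assignment_def)
        finally show ?thesis using \<open>v \<notin> B\<close> by simp
      qed
    qed
    ultimately show ?thesis by (auto simp: assignment_def)
  qed
  ultimately have "cap_solution 1 (reduced ((G, k, L), B)) (R, \<theta>)" by simp
  then show ?thesis by blast
qed

text \<open>No center serves more clients than there are vertices, so lowering capacities to that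
  number excludes no assignment.\<close>

lemma ft_solution_cap_capacities:
  assumes "pair_graph G"
  shows "ft_solution \<alpha> r (cap_capacities (G, k, L)) s \<longleftrightarrow> ft_solution \<alpha> r (G, k, L) s"
proof -
  interpret pair_graph G by fact
  have card_le: "card {u \<in> pverts G. \<phi> u = v} \<le> card (pverts G)" for \<phi> and v :: 'a
    using pair_finite_verts by (intro card_mono) auto
  have "(card {u \<in> pverts G. \<phi> u = v} \<le> (if card (pverts G) < L v then card (pverts G) else L v)) \<longleftrightarrow>
      card {u \<in> pverts G. \<phi> u = v} \<le> L v" for \<phi> v
    using card_le[of \<phi> v] by auto
  then have "assignment G (\<lambda>u. if card (pverts G) < L u then card (pverts G) else L u) = assignment G L"
    by (intro ext) (simp only: assignment_def)
  then show ?thesis by (cases s) simp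
qed


section \<open>Programs for the algorithm\<close>

lemma ptime_fun_at:
  assumes "ptime A enc (\<lambda>a. enc_fun (G a) (f a))" "ptime A enc (\<lambda>a. Num (u a))"
    and "\<And>a. a \<in> A \<Longrightarrow> u a < card (pverts (G a))"
  shows "ptime A enc (\<lambda>a. Num (f a (u a)))"
  by (rule ptime_cong[OF ptime_nth[OF assms(1)[unfolded enc_fun_def] assms(2)]])
    (use assms(3) in auto)

lemma ptime_mem:
  assumes "ptime A enc (\<lambda>a. enc_set (G a) (X a))" "ptime A enc (\<lambda>a. Num (u a))"
    and "\<And>a. a \<in> A \<Longrightarrow> u a < card (pverts (G a))"
  shows "ptime A enc (\<lambda>a. Bool (u a \<in> X a))"
  by (rule ptime_cong[OF ptime_fun_at[OF assms(1)[unfolded enc_set_def] assms(2,3)]]) auto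

lemma counts_fun: "ptime A enc (\<lambda>a. enc_fun (G a) (f a)) \<Longrightarrow> counts A enc (\<lambda>a. card (pverts (G a)))"
  unfolding enc_fun_def by (rule countsI) auto

lemma counts_graph: "ptime A enc (\<lambda>a. enc_graph (G a)) \<Longrightarrow> counts A enc (\<lambda>a. card (pverts (G a)))"
  unfolding enc_graph_def by (rule countsI) auto

lemma ptime_enc_fun:
  assumes "counts A enc (\<lambda>a. card (pverts (G a)))"
    and "ptime (idx A (\<lambda>a. card (pverts (G a)))) (enc_idx enc) (\<lambda>x. Num (f (fst x) (snd x)))"
  shows "ptime A enc (\<lambda>a. enc_fun (G a) (f a))"
  unfolding enc_fun_def by (rule ptime_map[OF assms])

lemma ptime_enc_set:
  assumes "counts A enc (\<lambda>a. card (pverts (G a)))"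
    and "ptime (idx A (\<lambda>a. card (pverts (G a)))) (enc_idx enc) (\<lambda>x. Bool (snd x \<in> X (fst x)))"
  shows "ptime A enc (\<lambda>a. enc_set (G a) (X a))"
  unfolding enc_set_def
  by (rule ptime_enc_fun[OF assms(1)]) (rule ptime_cong[OF assms(2)], auto)

lemma ptime_arc:
  assumes G: "ptime A enc (\<lambda>a. enc_graph (G a))"
    and u: "ptime A enc (\<lambda>a. Num (u a))" "\<And>a. a \<in> A \<Longrightarrow> u a < card (pverts (G a))"
    and v: "ptime A enc (\<lambda>a. Num (v a))" "\<And>a. a \<in> A \<Longrightarrow> v a < card (pverts (G a))"
  shows "ptime A enc (\<lambda>a. Bool ((u a, v a) \<in> parcs (G a)))"
proof -
  have "ptime A enc (\<lambda>a. enc_set (G a) {w. (u a, w) \<in> parcs (G a)})"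
    by (rule ptime_cong[OF ptime_nth[OF G[unfolded enc_graph_def] u(1)]]) (use u(2) in auto)
  from ptime_mem[OF this v] show ?thesis by simp
qed

text \<open>Source and target belong to the input, because the induction on the radius applies the
  program for \<open>l\<close> to a new target.\<close>

definition pairs :: "(nat pair_pre_digraph \<times> nat \<times> nat) set" where
  "pairs = {(G, u, v). u < card (pverts G) \<and> v < card (pverts G)}"

definition enc_pair :: "nat pair_pre_digraph \<times> nat \<times> nat \<Rightarrow> val" where
  "enc_pair x = Cell (enc_graph (fst x)) (Cell (Num (fst (snd x))) (Num (snd (snd x))))"

text \<open>The radius is fixed outside the program. Each increment wraps one more search over the
  vertices around the previous program, so the time is polynomial for every fixed
  \<open>l\<close>.\<close>

lemma ptime_reach_within_pairs:
  "ptime pairs enc_pair (\<lambda>x. Bool (reach_within (fst x) l (fst (snd x)) (snd (snd x))))"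
proof -
  have "ptime pairs enc_pair (\<lambda>x. Cell (enc_graph (fst x)) (Cell (Num (fst (snd x))) (Num (snd (snd x)))))"
    by (rule ptime_cong[OF ptime_enc]) (auto simp: enc_pair_def)
  note G = ptime_First[OF this] and u = ptime_First[OF ptime_Second[OF this]]
    and v = ptime_Second[OF ptime_Second[OF this]]
  let ?A = "idx pairs (\<lambda>x. card (pverts (fst x)))"
  show ?thesis
  proof (induction l)
    case 0
    show ?case unfolding reach_within.simps by (rule ptime_eq[OF u v])
  next
    case (Suc l)
    have "ptime ?A (enc_idx enc_pair)
        (\<lambda>x. enc_pair (fst (fst x), fst (snd (fst x)), snd x))"
      unfolding enc_pair_def[of "(_, _)"] fst_conv snd_conv
      by (intro ptime_Cell ptime_idx_fst[OF G] ptime_idx_fst[OF u] ptime_idx_snd)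
    from ptime_comp[OF this Suc.IH]
    have 1: "ptime ?A (enc_idx enc_pair) (\<lambda>x. Bool (reach_within (fst (fst x)) l (fst (snd (fst x))) (snd x)))"
      by (auto simp: pairs_def)
    have 2: "ptime ?A (enc_idx enc_pair) (\<lambda>x. Bool ((snd x, snd (snd (fst x))) \<in> parcs (fst (fst x))))"
      by (rule ptime_arc[OF ptime_idx_fst[OF G] ptime_idx_snd _ ptime_idx_fst[OF v]])
        (auto simp: pairs_def)
    show ?case
      unfolding reach_within.simps
      by (intro ptime_or Suc.IH ptime_ex[OF counts_graph[OF G]] ptime_and 1 2)
  qed
qed

lemma ptime_reach_within:
  assumes "ptime A enc (\<lambda>a. enc_graph (G a))"
    and "ptime A enc (\<lambda>a. Num (u a))" "\<And>a. a \<in> A \<Longrightarrow> u a < card (pverts (G a))"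
    and "ptime A enc (\<lambda>a. Num (v a))" "\<And>a. a \<in> A \<Longrightarrow> v a < card (pverts (G a))"
  shows "ptime A enc (\<lambda>a. Bool (reach_within (G a) l (u a) (v a)))"
proof -
  have "ptime A enc (\<lambda>a. enc_pair (G a, u a, v a))"
    unfolding enc_pair_def fst_conv snd_conv by (intro ptime_Cell assms)
  from ptime_comp[OF this ptime_reach_within_pairs] show ?thesis
    using assms(3,5) by (simp add: pairs_def)
qed

section \<open>Components of states and neighborhoods\<close>

abbreviation graph_of :: "state \<Rightarrow> nat pair_pre_digraph" where
  "graph_of s \<equiv> fst (fst s)"

abbreviation budget :: "state \<Rightarrow> nat" where
  "budget s \<equiv> fst (snd (fst s))"

abbreviation capacity :: "state \<Rightarrow> nat \<Rightarrow> nat" where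
  "capacity s \<equiv> snd (snd (fst s))"

abbreviation backups :: "state \<Rightarrow> nat set" where
  "backups s \<equiv> snd s"

abbreviation order_of :: "state \<Rightarrow> nat" where
  "order_of s \<equiv> card (pverts (graph_of s))"

lemma inputsD:
  assumes "(G, k, L) \<in> inputs"
  shows "pair_graph G" "pverts G = {0..<card (pverts G)}" "card (pverts G) > 0" "finite (pverts G)"
proof -
  show "pair_graph G" using assms by (simp add: inputs_def)
  obtain n where n: "pverts G = {0..<n}" using assms by (auto simp: inputs_def)
  then show "pverts G = {0..<card (pverts G)}" "finite (pverts G)" by simp_all
  \<comment> \<open>Connectedness excludes the empty graph by definition.\<close>
  moreover have "pverts G \<noteq> {}"
    using assms by (simp add: inputs_def connected_def strongly_connected_def mk_symmetric_def)
  ultimately show "card (pverts G) > 0" by (simp add: card_gt_0_iff)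
qed

lemma statesD:
  assumes "s \<in> states"
  shows "pair_graph (graph_of s)" "pverts (graph_of s) = {0..<order_of s}" "order_of s > 0"
    "finite (pverts (graph_of s))" "backups s \<subseteq> pverts (graph_of s)"
    "\<And>v. v < order_of s \<longleftrightarrow> v \<in> pverts (graph_of s)"
proof -
  obtain G k L B where s: "s = ((G, k, L), B)" by (rule enc_state.cases[of s])
  have "(G, k, L) \<in> inputs" "B \<subseteq> pverts G" using assms by (auto simp: states_def s)
  then show 1: "pair_graph (graph_of s)" "pverts (graph_of s) = {0..<order_of s}" "order_of s > 0"
    "finite (pverts (graph_of s))" "backups s \<subseteq> pverts (graph_of s)"
    using inputsD[of G k L] by (auto simp: s)
  show "v < order_of s \<longleftrightarrow> v \<in> pverts (graph_of s)" for v
    by (subst 1(2)) simp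
qed

lemma enc_state_eq: "enc_state s = Cell (Cell (enc_graph (graph_of s)) (Cell (Num (budget s))
    (enc_fun (graph_of s) (capacity s)))) (enc_set (graph_of s) (backups s))"
  by (cases s rule: enc_state.cases) simp

lemma ptime_state_parts:
  assumes "ptime A enc (\<lambda>a. enc_state (s a))"
  shows "ptime A enc (\<lambda>a. enc_graph (graph_of (s a)))"
    "ptime A enc (\<lambda>a. Num (budget (s a)))"
    "ptime A enc (\<lambda>a. enc_fun (graph_of (s a)) (capacity (s a)))"
    "ptime A enc (\<lambda>a. enc_set (graph_of (s a)) (backups (s a)))"
proof -
  note 1 = assms[unfolded enc_state_eq]
  note 2 = ptime_First[OF 1]
  show "ptime A enc (\<lambda>a. enc_graph (graph_of (s a)))"
    "ptime A enc (\<lambda>a. Num (budget (s a)))"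
    "ptime A enc (\<lambda>a. enc_fun (graph_of (s a)) (capacity (s a)))"
    "ptime A enc (\<lambda>a. enc_set (graph_of (s a)) (backups (s a)))"
    by (rule ptime_First[OF 2] ptime_First[OF ptime_Second[OF 2]]
        ptime_Second[OF ptime_Second[OF 2]] ptime_Second[OF 1])+
qed

lemma ptime_nbhd:
  assumes G: "ptime A enc (\<lambda>a. enc_graph (G a))"
    "\<And>a. a \<in> A \<Longrightarrow> pair_graph (G a)" "\<And>a. a \<in> A \<Longrightarrow> pverts (G a) = {0..<card (pverts (G a))}"
    and U: "ptime A enc (\<lambda>a. enc_set (G a) (U a))" "\<And>a. a \<in> A \<Longrightarrow> U a \<subseteq> pverts (G a)"
    and v: "ptime A enc (\<lambda>a. Num (v a))" "\<And>a. a \<in> A \<Longrightarrow> v a < card (pverts (G a))"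
  shows "ptime A enc (\<lambda>a. Bool (v a \<in> nbhd (G a) l (U a)))"
proof -
  have "ptime A enc (\<lambda>a. Bool (\<exists>u<card (pverts (G a)). u \<in> U a \<and> reach_within (G a) l (v a) u))"
    by (intro ptime_ex[OF counts_graph[OF G(1)]] ptime_and ptime_mem[OF ptime_idx_fst[OF U(1)]]
        ptime_reach_within ptime_idx_snd ptime_idx_fst[OF G(1)] ptime_idx_fst[OF v(1)])
      (use v(2) in auto)
  then show ?thesis
  proof (rule ptime_cong)
    fix a assume a: "a \<in> A"
    have "u \<in> U a \<Longrightarrow> u < card (pverts (G a))" for u
      using U(2)[OF a] G(3)[OF a] by auto
    moreover have "v a \<in> pverts (G a)" by (subst G(3)[OF a]) (simp add: v(2)[OF a])
    ultimately have "(\<exists>u<card (pverts (G a)). u \<in> U a \<and> reach_within (G a) l (v a) u) \<longleftrightarrow>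
        v a \<in> nbhd (G a) l (U a)"
      using reach_within_iff_gdist_le[OF G(2)[OF a] G(3)[OF a] v(2)[OF a]]
      by (auto simp: nbhd_def)
    then show "Bool (\<exists>u<card (pverts (G a)). u \<in> U a \<and> reach_within (G a) l (v a) u) =
        Bool (v a \<in> nbhd (G a) l (U a))" by simp
  qed simp
qed

section \<open>Exhaustive search for a violating set\<close>

definition heavy :: "state \<Rightarrow> nat set \<Rightarrow> bool" where
  "heavy s U \<longleftrightarrow> sum (capacity s) (backups s \<inter> nbhd (graph_of s) 6 U) < sum (capacity s) U"

lemma violating_iff: "violating \<alpha> s U \<longleftrightarrow> U \<subseteq> pverts (graph_of s) \<and> card U \<le> \<alpha> \<and> heavy s U"
  by (cases s rule: enc_state.cases) (simp add: heavy_def)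

lemma ptime_if_0:
  assumes "ptime A enc (\<lambda>a. Bool (P a))" "ptime A enc (\<lambda>a. Num (u a))"
  shows "ptime A enc (\<lambda>a. Num (if P a then u a else 0))"
  by (rule ptime_cong[OF ptime_if_total[OF assms ptime_const[of _ _ "Num 0"]]]) auto

lemma ptime_nbhd_idx:
  assumes s: "ptime A enc (\<lambda>a. enc_state (s a))" "\<And>a. a \<in> A \<Longrightarrow> s a \<in> states"
    and U: "ptime A enc (\<lambda>a. enc_set (graph_of (s a)) (U a))" "\<And>a. a \<in> A \<Longrightarrow> U a \<subseteq> pverts (graph_of (s a))"
  shows "ptime (idx A (\<lambda>a. order_of (s a))) (enc_idx enc)
    (\<lambda>x. Bool (snd x \<in> nbhd (graph_of (s (fst x))) l (U (fst x))))"
proof (rule ptime_nbhd[OF ptime_idx_fst[OF ptime_state_parts(1)[OF s(1)]] _ _ ptime_idx_fst[OF U(1)] _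
      ptime_idx_snd])
  fix x assume "x \<in> idx A (\<lambda>a. order_of (s a))"
  then have x: "fst x \<in> A" "snd x < order_of (s (fst x))" by auto
  show "pair_graph (graph_of (s (fst x)))" by (rule statesD(1)[OF s(2)[OF x(1)]])
  show "pverts (graph_of (s (fst x))) = {0..<order_of (s (fst x))}"
    by (rule statesD(2)[OF s(2)[OF x(1)]])
  show "U (fst x) \<subseteq> pverts (graph_of (s (fst x)))" by (rule U(2)[OF x(1)])
  show "snd x < order_of (s (fst x))" by (rule x(2))
qed

lemma ptime_heavy:
  assumes s: "ptime A enc (\<lambda>a. enc_state (s a))" "\<And>a. a \<in> A \<Longrightarrow> s a \<in> states"
    and U: "ptime A enc (\<lambda>a. enc_set (graph_of (s a)) (U a))" "\<And>a. a \<in> A \<Longrightarrow> U a \<subseteq> pverts (graph_of (s a))"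
  shows "ptime A enc (\<lambda>a. Bool (heavy (s a) (U a)))"
proof -
  note parts = ptime_state_parts[OF s(1)]
  let ?n = "\<lambda>a. order_of (s a)"
  have "ptime (idx A ?n) (enc_idx enc) (\<lambda>x. Bool (snd x \<in> nbhd (graph_of (s (fst x))) 6 (U (fst x))))"
    by (rule ptime_nbhd_idx[OF s U])
  then have "ptime A enc (\<lambda>a. Bool (
      (\<Sum>v<?n a. if v \<in> backups (s a) \<and> v \<in> nbhd (graph_of (s a)) 6 (U a) then capacity (s a) v else 0) <
      (\<Sum>v<?n a. if v \<in> U a then capacity (s a) v else 0)))"
    by (intro ptime_less ptime_sum[OF counts_graph[OF parts(1)]] ptime_if_0 ptime_and
        ptime_mem[OF ptime_idx_fst[OF U(1)]] ptime_mem[OF ptime_idx_fst[OF parts(4)]]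
        ptime_fun_at[OF ptime_idx_fst[OF parts(3)]] ptime_idx_snd) auto
  then show ?thesis
  proof (rule ptime_cong)
    fix a assume a: "a \<in> A"
    note st = statesD[OF s(2)[OF a]]
    have "(\<Sum>v<?n a. if v \<in> X then capacity (s a) v else 0) = sum (capacity (s a)) X"
      if "X \<subseteq> pverts (graph_of (s a))" for X
    proof -
      have "{..<?n a} \<inter> {v. v \<in> X} = X" using that st(2) by auto
      then show ?thesis by (simp add: sum.If_cases)
    qed
    from this[of "backups (s a) \<inter> nbhd (graph_of (s a)) 6 (U a)"] this[of "U a"]
    show "Bool ((\<Sum>v<?n a. if v \<in> backups (s a) \<and> v \<in> nbhd (graph_of (s a)) 6 (U a)
          then capacity (s a) v else 0) <
        (\<Sum>v<?n a. if v \<in> U a then capacity (s a) v else 0)) = Bool (heavy (s a) (U a))"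
      using st(5) U(2)[OF a] by (simp add: heavy_def nbhd_def le_infI1)
  qed simp
qed

text \<open>Nested searches of depth \<open>j\<close>; vertices may be inserted repeatedly, so
  smaller sets are found as well. Returning the code of the set found, rather than a truth value,
  serves both the test and the update of the loop.\<close>

primrec search :: "nat \<Rightarrow> state \<Rightarrow> nat set \<Rightarrow> val" where
  "search 0 s U = (if heavy s U then enc_set (graph_of s) U else Num 0)"
| "search (Suc j) s U = first_nonzero (\<lambda>v. search j s (insert v U)) (order_of s)"

lemma search_sound:
  assumes "s \<in> states" "U \<subseteq> pverts (graph_of s)" "search j s U \<noteq> Num 0"
  shows "\<exists>W. W \<subseteq> pverts (graph_of s) \<and> card W \<le> card U + j \<and> heavy s W \<and> search j s U = enc_set (graph_of s) W"
  using assms(2,3)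
proof (induction j arbitrary: U)
  case 0
  then show ?case by (auto split: if_splits)
next
  case (Suc j)
  then obtain v where v: "v < order_of s" "search (Suc j) s U = search j s (insert v U)"
    using first_nonzero_cases[of "\<lambda>v. search j s (insert v U)" "order_of s"] by auto
  have "insert v U \<subseteq> pverts (graph_of s)" using v(1) Suc.prems(1) statesD(6)[OF assms(1)] by simp
  moreover have "search j s (insert v U) \<noteq> Num 0" using Suc.prems(2) v(2) by simp
  ultimately obtain W where W: "W \<subseteq> pverts (graph_of s)" "card W \<le> card (insert v U) + j" "heavy s W"
    "search j s (insert v U) = enc_set (graph_of s) W"
    using Suc.IH by blast
  have "finite U" using Suc.prems(1) statesD(4)[OF assms(1)] finite_subset by blast
  then have "card (insert v U) \<le> Suc (card U)" by (simp add: card_insert_if)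
  then show ?case using W v(2) by (intro exI[of _ W]) simp
qed

text \<open>A vector of positive length is a \<open>Cell\<close>, so the code of a set is never
  mistaken for an unsuccessful search.\<close>

lemma enc_set_nonzero: "s \<in> states \<Longrightarrow> enc_set (graph_of s) U \<noteq> Num 0"
  using statesD(3) by (simp add: enc_set_def enc_fun_def)

lemma search_complete:
  assumes "s \<in> states" "W \<subseteq> pverts (graph_of s)" "heavy s W" "U \<subseteq> W" "card (W - U) \<le> j"
  shows "search j s U \<noteq> Num 0"
  using assms(4,5)
proof (induction j arbitrary: U)
  case 0
  have "finite W" using assms(2) statesD(4)[OF assms(1)] finite_subset by blast
  then have "U = W" using 0 by auto
  then show ?case using assms(3) enc_set_nonzero[OF assms(1)] by simp
next
  case (Suc j)
  have finW: "finite W" using assms(2) statesD(4)[OF assms(1)] finite_subset by blast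
  have "W \<noteq> {}" using assms(3) by (auto simp: heavy_def)
  \<comment> \<open>When \<open>U\<close> has already grown to \<open>W\<close>, the remaining
    levels insert an old element again. There is one, since the empty set is never heavy.\<close>
  obtain v where v: "v \<in> W" "W \<noteq> U \<Longrightarrow> v \<notin> U"
    using \<open>W \<noteq> {}\<close> Suc.prems(1) by blast
  have "card (W - insert v U) \<le> j"
  proof (cases "W = U")
    case False
    then have "card (W - insert v U) < card (W - U)"
      using v finW by (intro psubset_card_mono) auto
    then show ?thesis using Suc.prems(2) by simp
  next
    case True
    then have "W - insert v U = {}" by auto
    then show ?thesis by (simp only: card.empty le0)
  qed
  then have "search j s (insert v U) \<noteq> Num 0" using v(1) Suc by blast
  moreover have "v < order_of s" using v(1) assms(2) statesD(6)[OF assms(1)] by blast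
  ultimately show ?case unfolding search.simps first_nonzero_eq_0_iff by blast
qed

lemma search_iff:
  assumes "s \<in> states"
  shows "search \<alpha> s {} \<noteq> Num 0 \<longleftrightarrow> (\<exists>U. violating \<alpha> s U)"
proof
  assume "search \<alpha> s {} \<noteq> Num 0"
  from search_sound[OF assms _ this] show "\<exists>U. violating \<alpha> s U" by (auto simp: violating_iff)
next
  assume "\<exists>U. violating \<alpha> s U"
  then show "search \<alpha> s {} \<noteq> Num 0"
    using search_complete[OF assms, of _ "{}" \<alpha>] by (auto simp: violating_iff)
qed

definition set_states :: "(state \<times> nat set) set" where
  "set_states = {(s, U). s \<in> states \<and> U \<subseteq> pverts (graph_of s)}"

definition enc_set_state :: "state \<times> nat set \<Rightarrow> val" where
  "enc_set_state x = Cell (enc_state (fst x)) (enc_set (graph_of (fst x)) (snd x))"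

lemma ptime_search: "ptime set_states enc_set_state (\<lambda>x. search j (fst x) (snd x))"
proof -
  have *: "ptime set_states enc_set_state (\<lambda>x. Cell (enc_state (fst x)) (enc_set (graph_of (fst x)) (snd x)))"
    by (rule ptime_cong[OF ptime_enc]) (auto simp: enc_set_state_def)
  note s = ptime_First[OF *] and U = ptime_Second[OF *]
  note n = counts_graph[OF ptime_state_parts(1)[OF s]]
  show ?thesis
  proof (induction j)
    case 0
    show ?case
      unfolding search.simps
      by (intro ptime_if_total ptime_heavy s U ptime_const) (auto simp: set_states_def)
  next
    case (Suc j)
    let ?A = "idx set_states (\<lambda>x. order_of (fst x))"
    have ins: "ptime (idx ?A (\<lambda>x. order_of (fst (fst x)))) (enc_idx (enc_idx enc_set_state))
        (\<lambda>x. Bool (snd x = snd (fst x) \<or> snd x \<in> snd (fst (fst x))))"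
      by (intro ptime_or ptime_eq ptime_idx_snd ptime_idx_fst[OF ptime_idx_snd]
          ptime_mem[OF ptime_idx_fst[OF ptime_idx_fst[OF U]]]) auto
    have "ptime ?A (enc_idx enc_set_state)
        (\<lambda>x. enc_set_state (fst (fst x), insert (snd x) (snd (fst x))))"
      unfolding enc_set_state_def[of "(_, _)"] fst_conv snd_conv
      by (intro ptime_Cell ptime_idx_fst[OF s] ptime_enc_set counts_idx[OF n])
        (use ins in simp)
    moreover have "(fst (fst x), insert (snd x) (snd (fst x))) \<in> set_states" if "x \<in> ?A" for x
      using that statesD(6) by (auto simp: set_states_def)
    ultimately have "ptime ?A (enc_idx enc_set_state)
        (\<lambda>x. search j (fst (fst x)) (insert (snd x) (snd (fst x))))"
      using ptime_comp[OF _ Suc.IH] by fastforce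
    then show ?case unfolding search.simps by (rule ptime_first_nonzero[OF n])
  qed
qed

lemma ptime_search_all: "ptime states enc_state (\<lambda>s. search \<alpha> s {})"
proof -
  have "ptime states enc_state (\<lambda>s. enc_set_state (s, {}))"
    unfolding enc_set_state_def fst_conv snd_conv
    by (intro ptime_Cell ptime_enc ptime_enc_set counts_graph[OF ptime_state_parts(1)[OF ptime_enc]])
      (simp add: ptime_const)
  from ptime_comp[OF this ptime_search] show ?thesis by (simp add: set_states_def)
qed

lemma ptime_replace:
  assumes s: "ptime A enc (\<lambda>a. enc_state (s a))" "\<And>a. a \<in> A \<Longrightarrow> s a \<in> states"
    and U: "ptime A enc (\<lambda>a. enc_set (graph_of (s a)) (U a))" "\<And>a. a \<in> A \<Longrightarrow> U a \<subseteq> pverts (graph_of (s a))"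
  shows "ptime A enc (\<lambda>a. enc_state (replace (s a) (U a)))"
proof -
  note parts = ptime_state_parts[OF s(1)]
  let ?n = "\<lambda>a. order_of (s a)"
  have nb: "ptime (idx A ?n) (enc_idx enc) (\<lambda>x. Bool (snd x \<in> nbhd (graph_of (s (fst x))) 6 (U (fst x))))"
    by (rule ptime_nbhd_idx[OF s U])
  have "ptime (idx A ?n) (enc_idx enc) (\<lambda>x. Bool
      ((snd x \<in> backups (s (fst x)) \<and> \<not> snd x \<in> nbhd (graph_of (s (fst x))) 6 (U (fst x))) \<or> snd x \<in> U (fst x)))"
    by (intro ptime_or ptime_and ptime_not nb ptime_mem[OF ptime_idx_fst[OF U(1)]]
        ptime_mem[OF ptime_idx_fst[OF parts(4)]] ptime_idx_snd) auto
  then have "ptime A enc (\<lambda>a. enc_set (graph_of (s a)) (backups (s a) - nbhd (graph_of (s a)) 6 (U a) \<union> U a))"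
    by (intro ptime_enc_set counts_graph[OF parts(1)]) simp
  with parts have "ptime A enc (\<lambda>a. Cell (Cell (enc_graph (graph_of (s a))) (Cell (Num (budget (s a)))
      (enc_fun (graph_of (s a)) (capacity (s a)))))
      (enc_set (graph_of (s a)) (backups (s a) - nbhd (graph_of (s a)) 6 (U a) \<union> U a)))"
    by (intro ptime_Cell)
  then show ?thesis
  proof (rule ptime_cong)
    show "Cell (Cell (enc_graph (graph_of (s a))) (Cell (Num (budget (s a)))
      (enc_fun (graph_of (s a)) (capacity (s a)))))
      (enc_set (graph_of (s a)) (backups (s a) - nbhd (graph_of (s a)) 6 (U a) \<union> U a)) =
      enc_state (replace (s a) (U a))" for a
      by (cases "s a" rule: enc_state.cases) simp
  qed simp
qed

text \<open>The search outputs the code of a violating set; letting \<open>W s\<close> be a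
  violating set with this code makes the choice a computable function.\<close>

lemma ptime_update:
  obtains W where "\<And>s. s \<in> states \<Longrightarrow> \<exists>U. violating \<alpha> s U \<Longrightarrow> violating \<alpha> s (W s)"
    "ptime {s \<in> states. \<exists>U. violating \<alpha> s U} enc_state (\<lambda>s. enc_state (replace s (W s)))"
proof -
  let ?A = "{s \<in> states. \<exists>U. violating \<alpha> s U}"
  have "\<forall>s\<in>?A. \<exists>W. violating \<alpha> s W \<and> search \<alpha> s {} = enc_set (graph_of s) W"
  proof
    fix s assume "s \<in> ?A"
    then have "s \<in> states" "search \<alpha> s {} \<noteq> Num 0" using search_iff by auto
    from search_sound[OF this(1) _ this(2)]
    show "\<exists>W. violating \<alpha> s W \<and> search \<alpha> s {} = enc_set (graph_of s) W" by (auto simp: violating_iff)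
  qed
  from bchoice[OF this] obtain W where
    W: "\<And>s. s \<in> ?A \<Longrightarrow> violating \<alpha> s (W s)" "\<And>s. s \<in> ?A \<Longrightarrow> search \<alpha> s {} = enc_set (graph_of s) (W s)"
    by blast
  have "ptime ?A enc_state (\<lambda>s. enc_set (graph_of s) (W s))"
    by (rule ptime_cong[OF ptime_subset[OF ptime_search_all[of \<alpha>]]]) (use W(2) in auto)
  then have "ptime ?A enc_state (\<lambda>s. enc_state (replace s (W s)))"
    by (intro ptime_replace ptime_enc) (use W(1) in \<open>auto simp: violating_iff\<close>)
  with W(1) show thesis by (intro that) auto
qed

section \<open>Initialization, reduction, output and assembly\<close>

lemma ptime_init: "ptime inputs enc_input (\<lambda>I. enc_state (cap_capacities I, {}))"
proof -
  have "ptime inputs enc_input (\<lambda>I. Cell (enc_graph (fst I)) (Cell (Num (fst (snd I)))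
      (enc_fun (fst I) (snd (snd I)))))"
    by (rule ptime_cong[OF ptime_enc]) auto
  note G = ptime_First[OF this] and k = ptime_First[OF ptime_Second[OF this]]
    and L = ptime_Second[OF ptime_Second[OF this]]
  note n = counts_graph[OF G]
  let ?A = "idx inputs (\<lambda>I. card (pverts (fst I)))"
  have L': "ptime ?A (enc_idx enc_input) (\<lambda>x. Num (snd (snd (fst x)) (snd x)))"
    by (rule ptime_fun_at[OF ptime_idx_fst[OF L] ptime_idx_snd]) auto
  \<comment> \<open>With truncated subtraction, subtracting the excess over
    \<open>card (pverts G)\<close> gives the minimum of capacity and order.\<close>
  have "ptime ?A (enc_idx enc_input)
      (\<lambda>x. Num (snd (snd (fst x)) (snd x) - (snd (snd (fst x)) (snd x) - card (pverts (fst (fst x))))))"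
    by (intro ptime_diff L' ptime_idx_fst[OF ptime_count[OF n]])
  then have "ptime inputs enc_input (\<lambda>I. enc_fun (fst I)
      (\<lambda>v. snd (snd I) v - (snd (snd I) v - card (pverts (fst I)))))"
    by (rule ptime_enc_fun[OF n])
  moreover have "ptime inputs enc_input (\<lambda>I. enc_set (fst I) {})"
    by (intro ptime_enc_set n) (simp add: ptime_const)
  ultimately have "ptime inputs enc_input (\<lambda>I. Cell (Cell (enc_graph (fst I)) (Cell (Num (fst (snd I)))
      (enc_fun (fst I) (\<lambda>v. snd (snd I) v - (snd (snd I) v - card (pverts (fst I)))))))
      (enc_set (fst I) {}))"
    by (intro ptime_Cell G k)
  then show ?thesis
  proof (rule ptime_cong)
    fix I :: "nat kcenter" assume "I \<in> inputs"
    obtain G k L where I: "I = (G, k, L)" by (cases I)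
    have "(\<lambda>v. L v - (L v - card (pverts G))) = (\<lambda>v. if card (pverts G) < L v then card (pverts G) else L v)"
      by auto
    then show "Cell (Cell (enc_graph (fst I)) (Cell (Num (fst (snd I)))
      (enc_fun (fst I) (\<lambda>v. snd (snd I) v - (snd (snd I) v - card (pverts (fst I)))))))
      (enc_set (fst I) {}) = enc_state (cap_capacities I, {})"
      by (simp add: I)
  qed simp
qed

lemma ptime_reduce: "ptime states enc_state (\<lambda>s. enc_input (reduced s))"
proof -
  note parts = ptime_state_parts[OF ptime_enc[of states enc_state]]
  note n = counts_graph[OF parts(1)]
  let ?A = "idx states order_of"
  have B: "ptime ?A (enc_idx enc_state) (\<lambda>x. Bool (snd x \<in> backups (fst x)))"
    by (rule ptime_mem[OF ptime_idx_fst[OF parts(4)] ptime_idx_snd]) auto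
  have L: "ptime ?A (enc_idx enc_state) (\<lambda>x. Num (if \<not> snd x \<in> backups (fst x) then capacity (fst x) (snd x) else 0))"
    by (intro ptime_if_0 ptime_not B ptime_fun_at[OF ptime_idx_fst[OF parts(3)] ptime_idx_snd]) auto
  have "ptime states enc_state (\<lambda>s. Cell (enc_graph (graph_of s)) (Cell
      (Num (budget s - (\<Sum>v<order_of s. of_bool (v \<in> backups s))))
      (enc_fun (graph_of s) (\<lambda>v. if \<not> v \<in> backups s then capacity s v else 0))))"
    by (intro ptime_Cell parts(1) ptime_diff parts(2) ptime_sum[OF n B] ptime_enc_fun[OF n L])
  then show ?thesis
  proof (rule ptime_cong)
    fix s assume s: "s \<in> states"
    obtain G k L B where eq: "s = ((G, k, L), B)" by (rule enc_state.cases[of s])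
    have "{..<card (pverts G)} \<inter> B = B"
      using statesD(2,5)[OF s] by (auto simp: eq)
    then have "(\<Sum>v<card (pverts G). of_bool (v \<in> B)) = card B"
      by (simp add: sum.If_cases of_bool_def)
    moreover have "(\<lambda>v. if \<not> v \<in> backups s then capacity s v else 0) = (\<lambda>v. if v \<in> B then 0 else L v)"
      by (auto simp: eq)
    ultimately show "Cell (enc_graph (graph_of s)) (Cell
      (Num (budget s - (\<Sum>v<order_of s. of_bool (v \<in> backups s))))
      (enc_fun (graph_of s) (\<lambda>v. if \<not> v \<in> backups s then capacity s v else 0))) = enc_input (reduced s)"
      by (simp only:) (simp add: eq)
  qed simp
qed

lemma ptime_output:
  "ptime calls enc_call (\<lambda>x. enc_result (graph_of (fst x)) (add_backups (fst x) (snd x)))"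
proof -
  have *: "ptime A enc_call (\<lambda>x. Cell (enc_result (graph_of (fst x)) (snd x)) (enc_state (fst x)))" for A
    by (rule ptime_cong[OF ptime_enc]) auto
  \<comment> \<open>Failure is \<open>Num 0\<close> and a solution is a \<open>Cell\<close>, so the
    code tells the cases apart. The terms with \<open>the\<close> are computed only on
    \<open>?A\<close>, where a solution is present.\<close>
  let ?A = "{x \<in> calls. enc_result (graph_of (fst x)) (snd x) \<noteq> Num 0}"
  let ?S = "\<lambda>x. fst (the (snd x))" and ?\<phi> = "\<lambda>x. snd (the (snd x))"
  have res: "enc_result (graph_of (fst x)) (snd x) = Cell (enc_set (graph_of (fst x)) (?S x)) (enc_fun (graph_of (fst x)) (?\<phi> x))"
    if "x \<in> ?A" for x
    using that by (cases "snd x") auto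
  have "ptime ?A enc_call (\<lambda>x. Cell (enc_set (graph_of (fst x)) (?S x)) (enc_fun (graph_of (fst x)) (?\<phi> x)))"
    by (rule ptime_cong[OF ptime_First[OF *]]) (rule refl, rule res)
  note S = ptime_First[OF this] and \<phi> = ptime_Second[OF this]
  note B = ptime_state_parts(4)[OF ptime_Second[OF *]]
  note n = counts_fun[OF \<phi>]
  have "ptime (idx ?A (\<lambda>x. order_of (fst x))) (enc_idx enc_call)
      (\<lambda>y. Bool (snd y \<in> ?S (fst y) \<or> snd y \<in> backups (fst (fst y))))"
    by (intro ptime_or ptime_mem[OF ptime_idx_fst[OF S]] ptime_mem[OF ptime_idx_fst[OF B]]
        ptime_idx_snd) auto
  then have "ptime ?A enc_call (\<lambda>x. enc_set (graph_of (fst x)) (?S x \<union> backups (fst x)))"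
    by (intro ptime_enc_set[OF n]) simp
  from ptime_Cell[OF this \<phi>]
  have "ptime calls enc_call (\<lambda>x. if enc_result (graph_of (fst x)) (snd x) \<noteq> Num 0
      then Cell (enc_set (graph_of (fst x)) (?S x \<union> backups (fst x))) (enc_fun (graph_of (fst x)) (?\<phi> x)) else Num 0)"
    by (rule ptime_if_val[OF ptime_First[OF *] _ ptime_const])
  then show ?thesis
  proof (rule ptime_cong)
    fix x
    show "(if enc_result (graph_of (fst x)) (snd x) \<noteq> Num 0
      then Cell (enc_set (graph_of (fst x)) (?S x \<union> backups (fst x))) (enc_fun (graph_of (fst x)) (?\<phi> x))
      else Num 0) = enc_result (graph_of (fst x)) (add_backups (fst x) (snd x))"
      by (cases x rule: enc_call.cases, cases "snd x") auto
  qed simp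
qed

lemma implementation_exists: "\<exists>p. implementation \<alpha> ALG p"
proof -
  obtain init where init: "poly_time_realizes init inputs enc_input
      (\<lambda>I y. y = enc_state (cap_capacities I, {}))"
    using ptime_init unfolding ptime_def by blast
  obtain test where "poly_time_realizes test states enc_state (\<lambda>s y. y = search \<alpha> s {})"
    using ptime_search_all unfolding ptime_def by blast
  then have test: "poly_time_realizes test states enc_state (\<lambda>s y. y \<noteq> Num 0 \<longleftrightarrow> (\<exists>U. violating \<alpha> s U))"
    by (rule realizes_mono) (use search_iff in simp)
  obtain W where W: "\<And>s. s \<in> states \<Longrightarrow> \<exists>U. violating \<alpha> s U \<Longrightarrow> violating \<alpha> s (W s)"
    "ptime {s \<in> states. \<exists>U. violating \<alpha> s U} enc_state (\<lambda>s. enc_state (replace s (W s)))"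
    by (rule ptime_update[of \<alpha>]) blast
  obtain update where "poly_time_realizes update {s \<in> states. \<exists>U. violating \<alpha> s U} enc_state
      (\<lambda>s y. y = enc_state (replace s (W s)))"
    using W(2) unfolding ptime_def by blast
  then have update: "poly_time_realizes update {s \<in> states. \<exists>U. violating \<alpha> s U} enc_state
      (\<lambda>s y. \<exists>U. violating \<alpha> s U \<and> y = enc_state (replace s U))"
    by (rule realizes_mono) (use W(1) in blast)
  obtain reduce where reduce: "poly_time_realizes reduce states enc_state (\<lambda>s y. y = enc_input (reduced s))"
    using ptime_reduce unfolding ptime_def by blast
  obtain out where "poly_time_realizes out calls enc_call
      (\<lambda>x y. y = enc_result (graph_of (fst x)) (add_backups (fst x) (snd x)))"
    using ptime_output unfolding ptime_def by blast
  then have out: "poly_time_realizes out calls enc_call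
      (\<lambda>(s, res) y. y = enc_result (fst (fst s)) (add_backups s res))"
    by (rule realizes_mono) auto
  show ?thesis
    unfolding implementation_def
    by (intro exI conjI, rule refl) (rule init test update reduce out)+
qed


section \<open>Correctness and running time\<close>

lemma realizes_subset: "poly_time_realizes p A enc R \<Longrightarrow> B \<subseteq> A \<Longrightarrow> poly_time_realizes p B enc R"
  unfolding poly_time_realizes_def by (meson subsetD)

lemma realizes_Ident: "poly_time_realizes (Prim Ident) A enc (\<lambda>a y. y = enc a)"
proof -
  have "exec (Prim Ident) x (vsize x + vsize x) x" for x
    using exec.Prim[of Ident x] by simp
  then show ?thesis
    unfolding realizes_iff
    by (intro exI[of _ "\<lambda>a. vsize (enc a) + vsize (enc a)"] conjI poly_bounded_add poly_bounded_self)
      blast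
qed

text \<open>The loop invariant: separation serves completeness, and the capacity bound limits the
  number of rounds.\<close>

definition good_states :: "nat \<Rightarrow> state set" where
  "good_states \<alpha> = {s \<in> states. separated (graph_of s) \<alpha> (backups s) \<and> (\<forall>v. capacity s v \<le> order_of s)}"

lemma replace_eq: "replace s U = (fst s, backups s - nbhd (graph_of s) 6 U \<union> U)"
  by (cases s rule: enc_state.cases) simp

lemma good_states_replace:
  assumes s: "s \<in> good_states \<alpha>" and U: "violating \<alpha> s U"
  shows "replace s U \<in> good_states \<alpha>"
proof -
  have st: "s \<in> states" using s by (simp add: good_states_def)
  have U': "U \<subseteq> pverts (graph_of s)" "card U \<le> \<alpha>" using U by (auto simp: violating_iff)
  have "separated (graph_of s) \<alpha> (backups s - nbhd (graph_of s) 6 U \<union> U)"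
    using s statesD[OF st] U' by (intro separated_replace) (auto simp: good_states_def)
  moreover have "(fst s, backups s - nbhd (graph_of s) 6 U \<union> U) \<in> states"
    using st U' by (cases s rule: enc_state.cases) (auto simp: states_def)
  ultimately show ?thesis using s by (simp add: good_states_def replace_eq)
qed

text \<open>\<open>U\<close> lies in its own neighborhood and hence does not meet what is kept of
  \<open>B\<close>. The exchange therefore gains all of \<open>L(U)\<close> and loses only
  \<open>L(B \<inter> N^6(U))\<close>, which is smaller.\<close>

lemma replace_increases:
  assumes s: "s \<in> states" and U: "violating \<alpha> s U"
  shows "sum (capacity s) (backups s) < sum (capacity s) (backups (replace s U))"
proof -
  let ?L = "capacity s" and ?B = "backups s" and ?N = "nbhd (graph_of s) 6 U"
  note st = statesD[OF s]
  have UV: "U \<subseteq> pverts (graph_of s)" and heavy: "sum ?L (?B \<inter> ?N) < sum ?L U"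
    using U by (auto simp: violating_iff heavy_def)
  have fin: "finite ?B" "finite U" using st(4,5) UV finite_subset by blast+
  have "U \<subseteq> ?N" using UV gdist_refl[OF st(1), of _ 6] by (force simp: nbhd_def)
  have "sum ?L ?B = sum ?L (?B \<inter> ?N) + sum ?L (?B - ?N)"
    by (rule sum.Int_Diff[OF fin(1)])
  also have "\<dots> < sum ?L U + sum ?L (?B - ?N)" using heavy by simp
  also have "\<dots> = sum ?L (?B - ?N \<union> U)"
    using fin \<open>U \<subseteq> ?N\<close> by (subst sum.union_disjoint) auto
  finally show ?thesis by (simp add: replace_eq)
qed

lemma order_le_vsize: "order_of s \<le> vsize (enc_state s)"
proof -
  have "order_of s \<le> vsize (enc_fun (graph_of s) (capacity s))"
    unfolding enc_fun_def by (rule order_trans[OF _ length_le_vsize]) simp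
  then show ?thesis by (simp add: enc_state_eq)
qed

lemma vsize_enc_set_le: "vsize (enc_set G X) \<le> 3 * card (pverts G) + 1"
proof -
  have "floorlog 2 1 \<le> 1" by (rule floorlog_leI) auto
  then have "vsize (enc_set G X) \<le> card (pverts G) * (2 + 1) + 1"
    unfolding enc_set_def enc_fun_def
    by (intro order_trans[OF vsize_enc_list_le[where c = 2]]) (auto simp: floorlog_def)
  then show ?thesis by simp
qed

lemma enc_call_eq: "enc_call (s, res) = Cell (enc_result (graph_of s) res) (enc_state s)"
  by (cases s rule: enc_state.cases) simp

text \<open>The measure is |V|^2 - L(B). States stay small, since the instance is never changed and
  the size of a characteristic vector depends on |V| only up to a linear bound. As the update may
  pick any violating set, a round is a relation and not a function.\<close>

lemma main_loop:
  assumes test: "poly_time_realizes test states enc_state (\<lambda>s y. y \<noteq> Num 0 \<longleftrightarrow> (\<exists>U. violating \<alpha> s U))"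
    and update: "poly_time_realizes update {s \<in> states. \<exists>U. violating \<alpha> s U} enc_state
      (\<lambda>s y. \<exists>U. violating \<alpha> s U \<and> y = enc_state (replace s U))"
  shows "poly_time_realizes (While test update) (good_states \<alpha>) enc_state
    (\<lambda>s y. \<exists>s'\<in>good_states \<alpha>. y = enc_state s' \<and> fst s' = fst s \<and> \<not> (\<exists>U. violating \<alpha> s' U))"
proof -
  define step where "step s s' \<longleftrightarrow> (\<exists>U. violating \<alpha> s U \<and> s' = replace s U)" for s s'
  define M where "M s = order_of s * order_of s - sum (capacity s) (backups s)" for s
  have steps: "fst s' = fst s" if "step\<^sup>*\<^sup>* s s'" for s s'
    using that by induction (auto simp: step_def replace_eq)
  have sub: "good_states \<alpha> \<subseteq> states" by (auto simp: good_states_def)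
  have "poly_time_realizes (While test update) (good_states \<alpha>) enc_state
    (\<lambda>s y. \<exists>s'\<in>good_states \<alpha>. y = enc_state s' \<and> step\<^sup>*\<^sup>* s s' \<and> \<not> (\<exists>U. violating \<alpha> s' U))"
  proof (rule realizes_While[where M = M])
    show "poly_time_realizes test (good_states \<alpha>) enc_state (\<lambda>s y. y \<noteq> Num 0 \<longleftrightarrow> (\<exists>U. violating \<alpha> s U))"
      by (rule realizes_subset[OF test sub])
    have "poly_time_realizes update {s \<in> good_states \<alpha>. \<exists>U. violating \<alpha> s U} enc_state
        (\<lambda>s y. \<exists>U. violating \<alpha> s U \<and> y = enc_state (replace s U))"
      by (rule realizes_subset[OF update]) (use sub in blast)
    then show "poly_time_realizes update {s \<in> good_states \<alpha>. \<exists>U. violating \<alpha> s U} enc_state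
        (\<lambda>s y. \<exists>s'\<in>good_states \<alpha>. y = enc_state s' \<and> step s s')"
      by (rule realizes_mono) (use good_states_replace in \<open>auto simp: step_def\<close>)
    show "poly_bounded {(s, s'). s \<in> good_states \<alpha> \<and> step\<^sup>*\<^sup>* s s'} (\<lambda>x. vsize (enc_state (fst x)))
        (\<lambda>x. vsize (enc_state (snd x)))"
    proof (rule poly_bounded_mono)
      show "poly_bounded {(s, s'). s \<in> good_states \<alpha> \<and> step\<^sup>*\<^sup>* s s'} (\<lambda>x. vsize (enc_state (fst x)))
          (\<lambda>x. vsize (enc_state (fst x)) + (3 * vsize (enc_state (fst x)) + 1))"
        by (intro poly_bounded_add poly_bounded_mult poly_bounded_const poly_bounded_self)
      fix x assume "x \<in> {(s, s'). s \<in> good_states \<alpha> \<and> step\<^sup>*\<^sup>* s s'}"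
      then have eq: "fst (snd x) = fst (fst x)" using steps by auto
      have "vsize (enc_set (graph_of (fst x)) (backups (snd x))) \<le> 3 * vsize (enc_state (fst x)) + 1"
        using vsize_enc_set_le[of "graph_of (fst x)" "backups (snd x)"] order_le_vsize[of "fst x"] by linarith
      then show "vsize (enc_state (snd x)) \<le> vsize (enc_state (fst x)) + (3 * vsize (enc_state (fst x)) + 1)"
        unfolding enc_state_eq eq by simp
    qed
    show "M s' < M s" if "s \<in> good_states \<alpha>" "s' \<in> good_states \<alpha>" "\<exists>U. violating \<alpha> s U" "step s s'" for s s'
    proof -
      obtain U where U: "violating \<alpha> s U" "s' = replace s U"
        using \<open>step s s'\<close> by (auto simp: step_def)
      have s: "s \<in> states" "s' \<in> states" using that sub by auto
      have eq: "fst s' = fst s" using U(2) by (simp add: replace_eq)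
      have lt: "sum (capacity s) (backups s) < sum (capacity s') (backups s')"
        using replace_increases[OF s(1) U(1)] U(2) eq by simp
      \<comment> \<open>\<open>M\<close> is a truncated difference; it decreases strictly because
        the new weight is still at most |V|^2.\<close>
      have "sum (capacity s') (backups s') \<le> card (backups s') * order_of s'"
        using that(2) sum_bounded_above[of "backups s'" "capacity s'" "order_of s'"]
        by (simp add: good_states_def)
      also have "\<dots> \<le> order_of s' * order_of s'"
        using statesD(4,5)[OF s(2)] by (intro mult_right_mono card_mono) auto
      finally show ?thesis using lt eq by (simp add: M_def)
    qed
    show "poly_bounded (good_states \<alpha>) (\<lambda>s. vsize (enc_state s)) M"
    proof (rule poly_bounded_mono)
      show "poly_bounded (good_states \<alpha>) (\<lambda>s. vsize (enc_state s)) (\<lambda>s. vsize (enc_state s) * vsize (enc_state s))"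
        by (intro poly_bounded_mult poly_bounded_self)
      show "M s \<le> vsize (enc_state s) * vsize (enc_state s)" for s
        unfolding M_def using mult_mono[OF order_le_vsize order_le_vsize, of s s] by simp
    qed
  qed
  then show ?thesis by (rule realizes_mono) (use steps in blast)
qed

text \<open>A failure is justified by the contrapositive of completeness, a solution by soundness.
  Both concern the lowered capacities, for which the fault-tolerant solutions are the same.\<close>

lemma final_solution:
  assumes I: "I \<in> inputs" and s: "s \<in> good_states \<alpha>" "fst s = cap_capacities I"
    and viol: "\<not> (\<exists>U. violating \<alpha> s U)"
    and res: "case res of None \<Rightarrow> \<not> (\<exists>x. cap_solution 1 (reduced s) x)
      | Some x \<Rightarrow> cap_solution \<beta> (reduced s) x"
  shows "case add_backups s res of None \<Rightarrow> \<not> (\<exists>x. ft_solution \<alpha> 1 I x)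
    | Some x \<Rightarrow> ft_solution \<alpha> (\<beta> + 6 * real \<alpha>) I x"
proof -
  obtain G k L where I_eq: "I = (G, k, L)" by (cases I)
  define L' where "L' u = (if L u > card (pverts G) then card (pverts G) else L u)" for u
  obtain B where s_eq: "s = ((G, k, L'), B)"
    using s(2) by (cases s) (simp add: I_eq L'_def[abs_def])
  have G: "pair_graph G" using I inputsD I_eq by blast
  have cap: "ft_solution \<alpha> r (G, k, L') x \<longleftrightarrow> ft_solution \<alpha> r I x" for r x
    using ft_solution_cap_capacities[OF G, of \<alpha> r k L x] unfolding I_eq by (simp add: L'_def[abs_def])
  have B: "B \<subseteq> pverts G" "separated G \<alpha> B"
    using s(1) statesD(5)[of s] by (auto simp: good_states_def s_eq)
  show ?thesis
  proof (cases res)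
    case None
    then have "\<not> (\<exists>x. cap_solution 1 (reduced ((G, k, L'), B)) x)" using res s_eq by simp
    then have "\<not> ft_solution \<alpha> 1 (G, k, L') x" for x
      using cap_solution_reduced[OF G B] by (cases x) blast
    then show ?thesis using None cap by (simp add: s_eq)
  next
    case (Some x)
    obtain S \<phi> where x: "x = (S, \<phi>)" by (cases x)
    have S: "S \<subseteq> pverts G" "card S \<le> k - card B"
      and \<phi>: "assignment G (\<lambda>u. if u \<in> B then 0 else L' u) \<beta> S \<phi>"
      using res by (auto simp: Some x s_eq)
    \<comment> \<open>Some vertex has to be assigned, so \<open>S\<close> is nonempty and
      \<open>k - card B\<close> is positive. Hence truncation did not occur and
      \<open>S \<union> B\<close> fits into the budget.\<close>
    obtain v where "v \<in> pverts G" using inputsD(3)[of G k L] I I_eq by fastforce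
    then have "\<phi> v \<in> S" using \<phi> by (auto simp: assignment_def)
    moreover have "finite S" using S(1) inputsD(4)[of G k L] I I_eq finite_subset by blast
    ultimately have "card S > 0" by (auto simp: card_gt_0_iff)
    then have "card (S \<union> B) \<le> k" using S(2) card_Un_le[of S B] by linarith
    moreover have "\<not> violating \<alpha> ((G, k, L'), B) U" for U using viol s_eq by blast
    ultimately have "ft_solution \<alpha> (\<beta> + 6 * real \<alpha>) (G, k, L') (S \<union> B, \<phi>)"
      using ft_solution_backup[OF G B(1) _ S(1) \<phi>] by blast
    then have "ft_solution \<alpha> (\<beta> + 6 * real \<alpha>) I (S \<union> B, \<phi>)" using cap by blast
    then show ?thesis by (simp add: Some x s_eq)
  qed
qed

text \<open>The final state of the loop is not determined by the input, so the part after the loop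
  is analyzed on all states where the loop may stop; \<open>fst s' = fst s\<close> ties them to the
  input.\<close>

lemma implementation_correct:
  assumes ALG: "cap_approximation \<beta> ALG" and p: "implementation \<alpha> ALG p"
  shows "ft_approximation \<alpha> (\<beta> + 6 * real \<alpha>) p"
proof -
  obtain init test update reduce out where
    p_eq: "p = Seq init (Seq (While test update) (Seq (Both (Seq reduce ALG) (Prim Ident)) out))"
    and init: "poly_time_realizes init inputs enc_input (\<lambda>I y. y = enc_state (cap_capacities I, {}))"
    and test: "poly_time_realizes test states enc_state (\<lambda>s y. y \<noteq> Num 0 \<longleftrightarrow> (\<exists>U. violating \<alpha> s U))"
    and update: "poly_time_realizes update {s \<in> states. \<exists>U. violating \<alpha> s U} enc_state
          (\<lambda>s y. \<exists>U. violating \<alpha> s U \<and> y = enc_state (replace s U))"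
    and reduce: "poly_time_realizes reduce states enc_state (\<lambda>s y. y = enc_input (reduced s))"
    and out: "poly_time_realizes out calls enc_call
          (\<lambda>(s, res) y. y = enc_result (fst (fst s)) (add_backups s res))"
    using p unfolding implementation_def by (elim exE conjE)
  let ?final = "{s \<in> good_states \<alpha>. \<not> (\<exists>U. violating \<alpha> s U)}"
  define ok where "ok s res \<longleftrightarrow> (case res of None \<Rightarrow> \<not> (\<exists>x. cap_solution 1 (reduced s) x)
      | Some x \<Rightarrow> cap_solution \<beta> (reduced s) x)" for s res
  have sub: "?final \<subseteq> states" by (auto simp: good_states_def)
  have reduced: "reduced s \<in> inputs" "fst (reduced s) = graph_of s" if "s \<in> states" for s
    using that by (cases s rule: enc_state.cases; simp add: states_def inputs_def)+
  have "poly_time_realizes (Seq reduce ALG) ?final enc_state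
      (\<lambda>s z. \<exists>I\<in>inputs. I = reduced s \<and> (\<exists>res. z = enc_result (fst I) res \<and>
        (case res of None \<Rightarrow> \<not> (\<exists>x. cap_solution 1 I x) | Some x \<Rightarrow> cap_solution \<beta> I x)))"
    by (rule realizes_Seq[OF realizes_subset[OF reduce sub]
          ALG[unfolded cap_approximation_def approximation_def]]) (use reduced(1) sub in auto)
  then have "poly_time_realizes (Seq reduce ALG) ?final enc_state
      (\<lambda>s z. \<exists>res. z = enc_result (graph_of s) res \<and> ok s res)"
    by (rule realizes_mono) (use reduced(2) sub in \<open>auto simp: ok_def\<close>)
  from realizes_Both[OF this realizes_Ident]
  have call: "poly_time_realizes (Both (Seq reduce ALG) (Prim Ident)) ?final enc_state
      (\<lambda>s z. \<exists>res. z = enc_call (s, res) \<and> ok s res)"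
    by (rule realizes_mono) (auto simp: enc_call_eq)
  have "poly_time_realizes (Seq (Both (Seq reduce ALG) (Prim Ident)) out) ?final enc_state
      (\<lambda>s z. \<exists>b\<in>calls. (fst b = s \<and> ok s (snd b)) \<and>
        (case b of (s, res) \<Rightarrow> \<lambda>y. y = enc_result (fst (fst s)) (add_backups s res)) z)"
  proof (rule realizes_Seq[OF call out])
    fix s z assume s: "s \<in> ?final" and "\<exists>res. z = enc_call (s, res) \<and> ok s res"
    then obtain res where res: "z = enc_call (s, res)" "ok s res" by blast
    have "s \<in> states" using s sub by blast
    \<comment> \<open>The output program is specified only for well-formed answers; the guarantee of
      \<open>ALG\<close> includes well-formedness.\<close>
    then have "(s, res) \<in> calls"
      using res(2)
      by (cases s rule: enc_state.cases) (auto simp: calls_def ok_def assignment_def)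
    with res show "\<exists>b\<in>calls. z = enc_call b \<and> fst b = s \<and> ok s (snd b)" by force
  qed
  then have tail: "poly_time_realizes (Seq (Both (Seq reduce ALG) (Prim Ident)) out) ?final enc_state
      (\<lambda>s z. \<exists>res. ok s res \<and> z = enc_result (graph_of s) (add_backups s res))"
    by (rule realizes_mono) auto
  have loop: "poly_time_realizes (Seq (While test update) (Seq (Both (Seq reduce ALG) (Prim Ident)) out))
      (good_states \<alpha>) enc_state (\<lambda>s z. \<exists>s'\<in>?final. fst s' = fst s \<and>
        (\<exists>res. ok s' res \<and> z = enc_result (graph_of s') (add_backups s' res)))"
    by (rule realizes_Seq[OF main_loop[OF test update] tail]) blast
  have "poly_time_realizes p inputs enc_input (\<lambda>I z. \<exists>s\<in>good_states \<alpha>. s = (cap_capacities I, {}) \<and>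
      (\<exists>s'\<in>?final. fst s' = fst s \<and>
        (\<exists>res. ok s' res \<and> z = enc_result (graph_of s') (add_backups s' res))))"
    unfolding p_eq
  proof (rule realizes_Seq[OF init loop])
    fix I y assume "I \<in> inputs" "y = enc_state (cap_capacities I, {})"
    moreover have "(cap_capacities I, {}) \<in> good_states \<alpha>" if "I \<in> inputs" for I
      using that
      by (cases I) (auto simp: good_states_def states_def inputs_def separated_empty)
    ultimately show "\<exists>s\<in>good_states \<alpha>. y = enc_state s \<and> s = (cap_capacities I, {})" by blast
  qed
  then show ?thesis
    unfolding ft_approximation_def approximation_def
  proof (rule realizes_mono)
    fix I z assume I: "I \<in> inputs" and "\<exists>s\<in>good_states \<alpha>. s = (cap_capacities I, {}) \<and>
      (\<exists>s'\<in>?final. fst s' = fst s \<and>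
        (\<exists>res. ok s' res \<and> z = enc_result (graph_of s') (add_backups s' res)))"
    then obtain s res where s: "s \<in> good_states \<alpha>" "\<not> (\<exists>U. violating \<alpha> s U)"
        "fst s = fst (cap_capacities I, {} :: nat set)"
      and res: "ok s res" "z = enc_result (graph_of s) (add_backups s res)"
      by blast
    have eq: "fst s = cap_capacities I" using s(3) by simp
    have "graph_of s = fst I" unfolding eq by (cases I) simp
    with final_solution[OF I s(1) eq s(2) res(1)[unfolded ok_def]] res(2)
    show "\<exists>res. z = enc_result (fst I) res \<and> (case res of None \<Rightarrow> \<not> (\<exists>x. ft_solution \<alpha> 1 I x)
        | Some x \<Rightarrow> ft_solution \<alpha> (\<beta> + 6 * real \<alpha>) I x)"
      by (intro exI[of _ "add_backups s res"] conjI) simp_all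
  qed
qed

theorem theorem2:
  fixes \<alpha> :: nat and \<beta> :: real and ALG :: prog
  assumes "cap_approximation \<beta> ALG"
  shows "(\<exists>p. implementation \<alpha> ALG p) \<and>
         (\<forall>p. implementation \<alpha> ALG p \<longrightarrow> ft_approximation \<alpha> (\<beta> + 6 * real \<alpha>) p)"
  using implementation_exists implementation_correct[OF assms] by blast

end
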